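(* Let $n\ge1$ be an integer, $p>1$, and let $q$ satisfy $$\max(1,p-1)<q<\frac{np-n+p}{n-p}$$ (with no upper bound on $q$ if $p\ge n$). Let $b\in C^1[0,1]$ satisfy $b(r)>0$ and $b'(r)<0$ for $r\in(0,1)$, and assume that the functions $\frac{r b'(r)}{b(r)}$ and $r b'(r)$ are non-increasing on $(0,1)$. Then the problem $$\varphi(u'(r))'+\frac{n-1}{r}\varphi(u'(r))+b(r)u^q=0,\quad r\in(0,1),\qquad u'(0)=0,\ u(1)=0,$$ has a unique positive solution.
   Context: Here $\varphi(t)=t|t|^{p-2}$ (with $\varphi(0)=0$). Solutions are classical: $u\in C^1[0,1]$ and $\varphi(u')\in C^1(0,1]$; $u$ is positive if $u(r)>0$ for $r\in[0,1)$. The equation is the radial form of $\Delta_p u+b(|x|)u^q=0$ in the unit ball of $\mathbb{R}^n$ with zero Dirichlet data. *)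

theory Defs
  imports "HOL-Analysis.Analysis"
begin

definition phi :: "real \<Rightarrow> real \<Rightarrow> real" where
  "phi p t = t * \<bar>t\<bar> powr (p - 2)"

text \<open>\<open>f\<close> is of class $C^1$ on \<open>S\<close> with derivative \<open>f'\<close>; at an endpoint of an interval \<open>S\<close>
  that belongs to \<open>S\<close> the derivative is one-sided. (The library's \<open>C1_differentiable_on\<close> asks
  for two-sided derivatives even there.)\<close>

definition has_C1_derivative_on ::
    "(real \<Rightarrow> real) \<Rightarrow> (real \<Rightarrow> real) \<Rightarrow> real set \<Rightarrow> bool" where
  "has_C1_derivative_on f f' S \<longleftrightarrow>
     (\<forall>x\<in>S. (f has_real_derivative f' x) (at x within S)) \<and> continuous_on S f'"

text \<open>On the intervals below the derivatives are unique, so the witnesses are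
  \<open>u'\<close>, the derivative of \<open>u\<close> on $[0,1]$, and \<open>w\<close>, the derivative of $\varphi(u')$ on $(0,1]$.
  Values of \<open>u\<close> outside $[0,1]$ are irrelevant.\<close>

definition positive_solution ::
    "nat \<Rightarrow> real \<Rightarrow> real \<Rightarrow> (real \<Rightarrow> real) \<Rightarrow> (real \<Rightarrow> real) \<Rightarrow> bool" where
  "positive_solution n p q b u \<longleftrightarrow>
     (\<exists>u' w.
        has_C1_derivative_on u u' {0..1} \<and>
        has_C1_derivative_on (\<lambda>r. phi p (u' r)) w {0<..1} \<and>
        (\<forall>r\<in>{0<..<1}. w r + (real n - 1) / r * phi p (u' r) + b r * u r powr q = 0) \<and>
        u' 0 = 0 \<and> u 1 = 0) \<and>
     (\<forall>r\<in>{0..<1}. u r > 0)"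

end

theory Submission
  imports Defs
begin

text \<open>With \<open>y = - \<phi>(u')\<close> and \<open>e = 1 / (p - 1)\<close> the equation is the first-order system
\<open>u' = - y powr e\<close>, \<open>(r^(n-1) y)' = r^(n-1) b u^q\<close>. It is singular only at the centre, and
there the regular solutions form a family \<open>u_a\<close> indexed by \<open>u(0) = a > 0\<close>
(\<open>solves_exists\<close>, \<open>solves_unique\<close>); the family depends continuously on \<open>a\<close>. Positive
solutions of the boundary value problem correspond to the zeros of \<open>a \<mapsto> u_a(1)\<close>.

\<^emph>\<open>Existence.\<close> Since \<open>q > p - 1\<close>, the descent of \<open>u_a\<close> is negligible against \<open>a\<close> when \<open>a\<close>
is small, so \<open>u_a(1) > 0\<close>. For large \<open>a\<close> the value \<open>u_a(1)\<close> is negative: if it were not,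
then \<open>u_a\<close> would be positive on \<open>[0,1)\<close>, and superlinearity would bound \<open>u_a\<close> and its
slope at a fixed radius independently of \<open>a\<close>. The Pohozaev function at that radius would then
be bounded too. But subcriticality makes this function increase near the centre, to at least a
constant times \<open>a powr C0\<close> with \<open>C0 > 0\<close>. The intermediate value theorem gives a zero.

\<^emph>\<open>Uniqueness.\<close> Put \<open>V = (- r u' / u)^(p-1)\<close>, \<open>Z = r^p b u^\<kappa>\<close> with \<open>\<kappa> = q - p + 1\<close>, and
\<open>\<beta> = r b' / b\<close>. In the time \<open>t = ln r\<close>,

  \<open>V' = H(V) + Z\<close>,  \<open>(ln Z)' = p + \<beta> - \<kappa> V^e\<close>,

where \<open>H\<close> is an explicit function of \<open>V\<close> alone. The weight enters only through the
nonincreasing function \<open>\<beta>\<close>. The Pohozaev function is nonnegative along a positive solution,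
which gives \<open>V' > 0\<close>, so both \<open>t\<close> and \<open>L = ln Z\<close> are functions of \<open>v = V\<close>, running over
all of \<open>(0,\<infinity>)\<close>. Compare two solutions at equal \<open>v\<close>. The one with the larger value at the
centre is ahead, \<open>t1 < t2\<close>, when \<open>v\<close> is small, and \<open>L1 - L2\<close> tends to 0 as \<open>v\<close> does. As
long as \<open>t1 < t2\<close>, the monotonicity of \<open>\<beta>\<close> keeps \<open>L1 \<ge> L2\<close>. Then the first solution moves
at least as fast, so \<open>t2 - t1\<close> does not decrease. But \<open>V\<close> becomes infinite at the zero of
\<open>u\<close>, which is \<open>r = 1\<close> for both solutions, so both times tend to 0 as \<open>v \<rightarrow> \<infinity>\<close>. This
contradiction is \<open>phase_curve_order\<close>.\<close>

section \<open>Auxiliary facts on real functions\<close>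

lemma powr_lipschitz:
  fixes c d e :: real
  assumes "0 < c"
  shows "\<exists>L\<ge>0. \<forall>x\<in>{c..d}. \<forall>y\<in>{c..d}. \<bar>x powr e - y powr e\<bar> \<le> L * \<bar>x - y\<bar>"
proof -
  have "compact ((\<lambda>x. e * x powr (e - 1)) ` {c..d})"
    using assms by (intro compact_continuous_image continuous_intros) auto
  then obtain L where L: "\<And>x. x \<in> {c..d} \<Longrightarrow> \<bar>e * x powr (e - 1)\<bar> \<le> L"
    using compact_imp_bounded bounded_real by (metis (no_types, lifting) imageI)
  have "\<bar>x powr e - y powr e\<bar> \<le> max L 0 * \<bar>x - y\<bar>" if "x \<in> {c..d}" "y \<in> {c..d}" for x y
    unfolding real_norm_def[symmetric]
  proof (rule field_differentiable_bound[where S = "{c..d}" and f' = "\<lambda>x. e * x powr (e - 1)"])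
    fix z assume z: "z \<in> {c..d}"
    show "((\<lambda>x. x powr e) has_real_derivative e * z powr (e - 1)) (at z within {c..d})"
      using z assms by (auto intro!: has_field_derivative_at_within has_real_derivative_powr)
    show "norm (e * z powr (e - 1)) \<le> max L 0" using L[OF z] by auto
  qed (use that in auto)
  then show ?thesis by (intro exI[of _ "max L 0"]) auto
qed

text \<open>The nonlinearity is cut off at negative arguments, so that the initial value problem has
solutions on all of \<open>[0,1]\<close>. For \<open>q > 1\<close> the cut-off power is still locally Lipschitz,
across 0 as well.\<close>

lemma pos_part_powr_lipschitz:
  fixes q A :: real
  assumes "1 < q" "0 \<le> A"
  shows "\<exists>L\<ge>0. \<forall>x\<le>A. \<forall>y\<le>A. \<bar>max x 0 powr q - max y 0 powr q\<bar> \<le> L * \<bar>x - y\<bar>"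
proof (intro exI[of _ "q * A powr (q - 1)"] conjI allI impI)
  have ord: "Y powr q - X powr q \<le> q * A powr (q - 1) * (Y - X)"
    if X: "0 \<le> X" "X < Y" "Y \<le> A" for X Y
  proof -
    obtain z where z: "X < z" "z < Y"
      "Y powr q - X powr q = (\<lambda>h. q * z powr (q - 1) * h) (Y - X)"
    proof (rule mvt[of X Y "\<lambda>x. x powr q" "\<lambda>x h. q * x powr (q - 1) * h"])
      show "continuous_on {X..Y} (\<lambda>x. x powr q)"
        using X assms by (intro continuous_on_powr') (auto intro: continuous_intros)
      show "((\<lambda>x. x powr q) has_derivative (\<lambda>h. q * x powr (q - 1) * h)) (at x)"
        if "X < x" "x < Y" for x
        using has_real_derivative_powr[of x q] that X by (simp add: has_field_derivative_def)
    qed (use X in auto)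
    have "z powr (q - 1) \<le> A powr (q - 1)" using z X assms by (intro powr_mono2) auto
    then show ?thesis using z X assms by (simp add: mult_left_mono mult_right_mono)
  qed
  fix x y assume xy: "x \<le> A" "y \<le> A"
  define X Y where "X = max x 0" and "Y = max y 0"
  have XY: "0 \<le> X" "X \<le> A" "0 \<le> Y" "Y \<le> A" using xy assms by (auto simp: X_def Y_def)
  have mono: "X < Y \<Longrightarrow> X powr q \<le> Y powr q" "Y < X \<Longrightarrow> Y powr q \<le> X powr q"
    using XY assms by (auto intro: powr_mono2)
  have "\<bar>X powr q - Y powr q\<bar> \<le> q * A powr (q - 1) * \<bar>X - Y\<bar>"
    using ord[of X Y] ord[of Y X] XY mono by (cases X Y rule: linorder_cases) auto
  also have "\<dots> \<le> q * A powr (q - 1) * \<bar>x - y\<bar>"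
    using assms by (intro mult_left_mono) (auto simp: X_def Y_def)
  finally show "\<bar>max x 0 powr q - max y 0 powr q\<bar> \<le> q * A powr (q - 1) * \<bar>x - y\<bar>"
    by (simp add: X_def Y_def)
qed (use assms in auto)

text \<open>The square of the negative part is differentiable, also at 0; this turns one-sided
differential inequalities for a function, valid only where it is negative, into monotonicity of
a smooth quantity.\<close>

lemma neg_part_square_deriv:
  "((\<lambda>x. (min x 0)\<^sup>2) has_real_derivative 2 * min x 0) (at x)" for x :: real
proof (cases x "0::real" rule: linorder_cases)
  case less
  have "((\<lambda>x. x\<^sup>2) has_real_derivative 2 * min x 0) (at x)"
    using less by (auto intro!: derivative_eq_intros)
  then show ?thesis
    by (rule has_field_derivative_transform_within_open[where S = "{..<0}"]) (use less in auto)
next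
  case equal
  have "((\<lambda>h. (min h 0)\<^sup>2 / h) \<longlongrightarrow> 0) (at (0::real))"
  proof (rule Lim_null_comparison)
    show "eventually (\<lambda>h. norm ((min h 0)\<^sup>2 / h) \<le> \<bar>h\<bar>) (at (0::real))"
      by (intro always_eventually allI) (auto simp: min_def power2_eq_square)
    show "((\<lambda>h. \<bar>h\<bar>) \<longlongrightarrow> 0) (at (0::real))" by (intro tendsto_eq_intros) auto
  qed
  then show ?thesis using equal by (simp add: DERIV_def)
next
  case greater
  have "((\<lambda>x. 0) has_real_derivative 2 * min x 0) (at x)"
    using greater by simp
  then show ?thesis
    by (rule has_field_derivative_transform_within_open[where S = "{0<..}"]) (use greater in auto)
qed

text \<open>Where it is negative \<open>g\<close> is nondecreasing, so from a negative value at \<open>c\<close> it can only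
go further down when followed backwards: the square of its negative part is nonincreasing on
\<open>[a,c]\<close>.\<close>

lemma negative_backwards:
  fixes g g' :: "real \<Rightarrow> real"
  assumes "a \<le> c"
    and der: "\<And>x. a \<le> x \<Longrightarrow> x \<le> c \<Longrightarrow> (g has_real_derivative g' x) (at x)"
    and mono: "\<And>x. a \<le> x \<Longrightarrow> x \<le> c \<Longrightarrow> g x < 0 \<Longrightarrow> 0 \<le> g' x"
    and neg: "g c < 0"
  shows "g a \<le> g c"
proof -
  have "(min (g c) 0)\<^sup>2 \<le> (min (g a) 0)\<^sup>2"
  proof (rule DERIV_nonpos_imp_nonincreasing[OF assms(1), of "\<lambda>x. (min (g x) 0)\<^sup>2"])
    fix x assume x: "a \<le> x" "x \<le> c"
    have "2 * min (g x) 0 * g' x \<le> 0"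
      using mono[OF x] by (cases "g x < 0") (auto simp: mult_nonpos_nonneg)
    then show "\<exists>y. ((\<lambda>x. (min (g x) 0)\<^sup>2) has_real_derivative y) (at x) \<and> y \<le> 0"
      using DERIV_chain2[OF neg_part_square_deriv der[OF x]] by blast
  qed
  then show ?thesis using neg by (auto simp: min_def power2_le_iff_abs_le abs_le_square_iff[symmetric] split: if_splits)
qed

text \<open>An increasing bijection from \<open>(0,1)\<close> onto \<open>(0,\<infinity>)\<close> with positive derivative has a
differentiable inverse; it is used to make the Emden-Fowler variable \<open>V\<close> the independent
variable.\<close>

lemma increasing_inverse:
  fixes f f' :: "real \<Rightarrow> real"
  assumes der: "\<And>r. 0 < r \<Longrightarrow> r < 1 \<Longrightarrow> (f has_real_derivative f' r) (at r)"
    and pos: "\<And>r. 0 < r \<Longrightarrow> r < 1 \<Longrightarrow> 0 < f' r"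
    and lim0: "(f \<longlongrightarrow> 0) (at_right 0)" and lim1: "filterlim f at_top (at_left 1)"
  obtains g where
    "\<And>v. 0 < v \<Longrightarrow> 0 < g v \<and> g v < 1 \<and> f (g v) = v"
    "\<And>v. 0 < v \<Longrightarrow> (g has_real_derivative 1 / f' (g v)) (at v)"
    "(g \<longlongrightarrow> 0) (at_right 0)" "(g \<longlongrightarrow> 1) at_top"
proof -
  have mono: "f r < f s" if "0 < r" "r < s" "s < 1" for r s
    using that by (intro DERIV_pos_imp_increasing[OF that(2)]) (metis der pos less_le_trans le_less_trans)
  have mono_iff: "f r < f s \<longleftrightarrow> r < s" if "0 < r" "r < 1" "0 < s" "s < 1" for r s
    using mono[of r s] mono[of s r] that by (cases r s rule: linorder_cases) auto
  have f_pos: "0 < f r" if r: "0 < r" "r < 1" for r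
  proof -
    have "0 \<le> f (r / 2)"
    proof (rule tendsto_upperbound[OF lim0])
      show "eventually (\<lambda>s. f s \<le> f (r / 2)) (at_right 0)"
        unfolding eventually_at_right_field using r
        by (intro exI[of _ "r / 2"]) (auto intro!: less_imp_le mono)
    qed auto
    also have "f (r / 2) < f r" using r by (intro mono) auto
    finally show ?thesis .
  qed
  have ex: "\<exists>r. 0 < r \<and> r < 1 \<and> f r = v" if v: "0 < v" for v
  proof -
    have "eventually (\<lambda>r. f r < v) (at_right 0)" using lim0 v by (rule order_tendstoD(2))
    then obtain c where c: "0 < c" "\<And>r. 0 < r \<Longrightarrow> r < c \<Longrightarrow> f r < v"
      unfolding eventually_at_right_field by auto
    define r1 where "r1 = min c 1 / 2"
    have r1: "0 < r1" "r1 < 1" "f r1 < v" using c(1) c(2)[of r1] by (auto simp: r1_def min_def)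
    have "eventually (\<lambda>r. v < f r) (at_left 1)"
      using lim1 by (simp add: filterlim_at_top_dense)
    then obtain d where d: "d < 1" "\<And>r. d < r \<Longrightarrow> r < 1 \<Longrightarrow> v < f r"
      unfolding eventually_at_left_field by auto
    define r2 where "r2 = (max d 0 + 1) / 2"
    have r2: "0 < r2" "r2 < 1" "v < f r2" using d(1) d(2)[of r2] by (auto simp: r2_def max_def)
    have "r1 < r2" using mono_iff[of r1 r2] r1 r2 by linarith
    moreover have "continuous_on {r1..r2} f"
      using r1 r2 by (intro continuous_at_imp_continuous_on ballI DERIV_isCont[OF der]) auto
    ultimately obtain r where "r1 \<le> r" "r \<le> r2" "f r = v"
      using IVT'[of f r1 v r2] r1 r2 by auto
    then show ?thesis using r1 r2 by (intro exI[of _ r]) auto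
  qed
  define g where "g v = (SOME r. 0 < r \<and> r < 1 \<and> f r = v)" for v
  have g: "0 < g v \<and> g v < 1 \<and> f (g v) = v" if "0 < v" for v
    unfolding g_def by (rule someI_ex[OF ex[OF that]])
  have gf: "g (f r) = r" if "0 < r" "r < 1" for r
    using g[OF f_pos[OF that]] mono_iff[of r "g (f r)"] mono_iff[of "g (f r)" r] that
    by (cases r "g (f r)" rule: linorder_cases) auto
  have dg: "(g has_real_derivative 1 / f' (g v)) (at v)" if v: "0 < v" for v
  proof -
    define d where "d = min (g v) (1 - g v) / 2"
    have d: "0 < d" "d < g v" "d < 1 - g v" using g[OF v] by (auto simp: d_def min_def)
    have "isCont g (f (g v))"
    proof (rule isCont_inverse_function[where f = f and x = "g v", OF d(1)])
      show "g (f z) = z" if "\<bar>z - g v\<bar> \<le> d" for z using that d by (intro gf) auto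
      show "isCont f z" if "\<bar>z - g v\<bar> \<le> d" for z
        using that d by (intro DERIV_isCont[OF der]) auto
    qed
    then have "isCont g v" using g[OF v] by simp
    then have "(g has_real_derivative inverse (f' (g v))) (at v)"
      using g v pos[of "g v"] der[of "g v"]
      by (intro DERIV_inverse_function[where f = f and a = 0 and b = "v + 1"]) auto
    then show ?thesis by (simp add: inverse_eq_divide)
  qed
  have g0: "(g \<longlongrightarrow> 0) (at_right 0)"
  proof (rule order_tendstoI)
    show "eventually (\<lambda>v. c < g v) (at_right 0)" if "c < 0" for c
      using eventually_at_right_less[of "0::real"] by eventually_elim (use g that in force)
    show "eventually (\<lambda>v. g v < c) (at_right 0)" if c: "0 < c" for c
    proof -
      define c' where "c' = min c 1 / 2"
      have c': "0 < c'" "c' < 1" "c' < c" using c by (auto simp: c'_def)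
      have "g v < c" if "0 < v" "v < f c'" for v
        using mono_iff[of "g v" c'] g[OF that(1)] that c' by auto
      then show ?thesis unfolding eventually_at_right_field using f_pos[OF c'(1,2)] by blast
    qed
  qed
  have g1: "(g \<longlongrightarrow> 1) at_top"
  proof (rule order_tendstoI)
    show "eventually (\<lambda>v. g v < c) at_top" if "1 < c" for c
      using eventually_gt_at_top[of "0::real"] by eventually_elim (use g that in force)
    show "eventually (\<lambda>v. c < g v) at_top" if c: "c < 1" for c
    proof -
      define c' where "c' = (max c 0 + 1) / 2"
      have c': "0 < c'" "c' < 1" "c < c'" using c by (auto simp: c'_def)
      show ?thesis using eventually_gt_at_top[of "f c'"]
      proof eventually_elim
        case (elim v)
        then have "0 < v" using f_pos[OF c'(1,2)] by simp
        then show ?case using mono_iff[of c' "g v"] g[of v] elim c' by auto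
      qed
    qed
  qed
  show ?thesis using g dg g0 g1 by (rule that)
qed

section \<open>The solution operator of the initial value problem\<close>

text \<open>Subcriticality is stated as positivity of the constant that the Pohozaev identity
produces. In this form it covers both \<open>p < n\<close>, where it is the upper bound on \<open>q\<close>, and
\<open>p \<ge> n\<close>, where it always holds. The monotonicity of \<open>r b' / b\<close>, the logarithmic slope of the
weight, is written out pointwise.\<close>

locale radial_problem =
  fixes n :: nat and p q :: real and b b' :: "real \<Rightarrow> real"
  assumes n_ge_1: "1 \<le> n" and p_gt_1: "1 < p" and q_gt_1: "1 < q" and q_gt: "p - 1 < q"
    and subcritical: "0 < real n - (real n - p) * (q + 1) / p"
    and b_deriv: "\<And>r. r \<in> {0..1} \<Longrightarrow> (b has_real_derivative b' r) (at r within {0..1})"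
    and b'_cont: "continuous_on {0..1} b'"
    and b_pos: "\<And>r. 0 < r \<Longrightarrow> r < 1 \<Longrightarrow> 0 < b r"
    and b'_neg: "\<And>r. 0 < r \<Longrightarrow> r < 1 \<Longrightarrow> b' r < 0"
    and log_slope_antimono:
      "\<And>r s. 0 < r \<Longrightarrow> r \<le> s \<Longrightarrow> s < 1 \<Longrightarrow> s * b' s / b s \<le> r * b' r / b r"
begin

definition e :: real where "e = 1 / (p - 1)"

lemma e_pos: "0 < e" using p_gt_1 by (simp add: e_def)

lemma b_cont: "continuous_on {0..1} b"
  using b_deriv by (rule DERIV_continuous_on)

lemma b_at: "0 < r \<Longrightarrow> r < 1 \<Longrightarrow> (b has_real_derivative b' r) (at r)"
  using b_deriv[of r] by (simp add: at_within_Icc_at)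

lemma b_decreasing: "0 \<le> r \<Longrightarrow> r \<le> s \<Longrightarrow> s \<le> 1 \<Longrightarrow> b s \<le> b r"
proof (cases "r = s")
  case False
  assume "0 \<le> r" "r \<le> s" "s \<le> 1"
  with False have "b s < b r"
    by (intro DERIV_neg_imp_decreasing_open[of r s b])
       (auto intro!: b_at b'_neg continuous_on_subset[OF b_cont] exI conjI)
  then show ?thesis by simp
qed auto

lemma b_0_pos: "0 < b 0"
  using b_pos[of "1/2"] b_decreasing[of 0 "1/2"] by simp

lemma b_nonneg: "r \<in> {0..1} \<Longrightarrow> 0 \<le> b r"
proof -
  assume r: "r \<in> {0..1}"
  have "((\<lambda>s. b s) \<longlongrightarrow> b 1) (at 1 within {0..1})"
    using b_cont by (auto simp: continuous_on)
  then have lim: "(b \<longlongrightarrow> b 1) (at_left 1)"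
    by (rule tendsto_within_subset[THEN tendsto_mono[rotated]])
       (auto simp: at_within_Icc_at_left)
  have "eventually (\<lambda>s. 0 \<le> b s) (at_left 1)"
    using eventually_at_left[of 0 "1::real"] b_pos by (auto intro!: less_imp_le exI[of _ "0::real"])
  with lim have "0 \<le> b 1" by (intro tendsto_lowerbound[OF lim]) auto
  then show ?thesis using b_decreasing[of r 1] r by auto
qed

text \<open>\<open>r J(r) = r^(1-n) \<integral>_0^r t^(n-1) F(t) dt\<close> is the value of \<open>- \<phi>(u')\<close> that the equation
prescribes. Writing \<open>J\<close> as an average over the fixed interval \<open>[0,1]\<close> removes the
singularity of this formula at \<open>r = 0\<close>. The initial value problem \<open>u(0) = a\<close>, \<open>u'(0) = 0\<close>
thus becomes the fixed point equation \<open>u = a - S u\<close>.\<close>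

definition F :: "(real \<Rightarrow> real) \<Rightarrow> real \<Rightarrow> real" where
  "F u r = b r * max (u r) 0 powr q"

definition J :: "(real \<Rightarrow> real) \<Rightarrow> real \<Rightarrow> real" where
  "J u s = integral {0..1} (\<lambda>t. t ^ (n - 1) * F u (s * t))"

definition S :: "(real \<Rightarrow> real) \<Rightarrow> real \<Rightarrow> real" where
  "S u r = integral {0..r} (\<lambda>s. (s * J u s) powr e)"

lemma F_cont: "continuous_on {0..1} u \<Longrightarrow> continuous_on {0..1} (F u)"
  unfolding F_def using q_gt_1
  by (intro continuous_intros b_cont continuous_on_powr') auto

lemma F_nonneg: "r \<in> {0..1} \<Longrightarrow> 0 \<le> F u r"
  unfolding F_def using b_nonneg by auto

lemma scaled_cont:
  fixes f :: "real \<Rightarrow> real"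
  assumes f: "continuous_on {0..1} f" and s: "s \<in> {0..1}"
  shows "continuous_on {0..1} (\<lambda>t. t ^ k * f (s * t))"
proof -
  have "continuous_on {0..1} (\<lambda>t. f (s * t))"
    by (rule continuous_on_compose2[OF f]) (use s in \<open>auto intro!: continuous_intros mult_le_one\<close>)
  then show ?thesis by (intro continuous_intros)
qed

lemma J_cont: assumes "continuous_on {0..1} u" shows "continuous_on {0..1} (J u)"
proof -
  have "continuous_on ({0..1} \<times> cbox 0 1) (\<lambda>(s, t). t ^ (n - 1) * F u (s * t))"
  proof -
    have "continuous_on ({0..1} \<times> cbox 0 1) (\<lambda>z. F u (fst z * snd z))"
      by (rule continuous_on_compose2[OF F_cont[OF assms]])
         (auto intro!: continuous_intros mult_le_one)
    then show ?thesis unfolding case_prod_beta by (intro continuous_intros)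
  qed
  from integral_continuous_on_param[OF this] show ?thesis
    by (simp add: J_def[abs_def])
qed

lemma integral_power_n:
  assumes "0 \<le> d"
  shows "integral {0..d} (\<lambda>t. t ^ (n - 1) * c) = c * (d ^ n / n)"
proof -
  have "((\<lambda>t. t ^ (n - 1) * c) has_integral (d ^ n / n * c - 0 ^ n / n * c)) {0..d}"
  proof (rule fundamental_theorem_of_calculus)
    show "((\<lambda>t. t ^ n / n * c) has_vector_derivative x ^ (n - 1) * c) (at x within {0..d})" for x :: real
      using n_ge_1 unfolding has_real_derivative_iff_has_vector_derivative[symmetric]
      by (auto intro!: derivative_eq_intros)
  qed (use assms in auto)
  then have "integral {0..d} (\<lambda>t. t ^ (n - 1) * c) = d ^ n / n * c - 0 ^ n / n * c"
    by (rule integral_unique)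
  then show ?thesis using n_ge_1 by (simp add: power_0_left mult_ac)
qed

text \<open>The substitution \<open>t \<mapsto> r t\<close> recovers the flux integral of the equation.\<close>

lemma J_scaled:
  assumes "continuous_on {0..1} u" "r \<in> {0..1}"
  shows "r ^ n * J u r = integral {0..r} (\<lambda>t. t ^ (n - 1) * F u t)"
proof -
  have r_n: "r ^ n = r * r ^ (n - 1)" using n_ge_1 by (cases n) auto
  have "((\<lambda>t. r *\<^sub>R ((r * t) ^ (n - 1) * F u (r * t))) has_integral
          integral {r * 0..r * 1} (\<lambda>t. t ^ (n - 1) * F u t)) {0..1}"
    using assms
    by (intro has_integral_substitution[where c = 0 and d = 1 and g = "\<lambda>t. r * t"])
       (auto intro!: derivative_eq_intros continuous_intros F_cont mult_le_one)
  then have "((\<lambda>t. r ^ n * (t ^ (n - 1) * F u (r * t))) has_integral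
          integral {0..r} (\<lambda>t. t ^ (n - 1) * F u t)) {0..1}"
    by (simp add: r_n power_mult_distrib mult_ac)
  then show ?thesis
    unfolding J_def by (metis integral_mult_right integral_unique)
qed

text \<open>The lower bound \<open>m > 0\<close> on a core interval \<open>[0,d]\<close> keeps \<open>J\<close> away from 0. This is
what makes \<open>J powr e\<close> Lipschitz in \<open>J\<close> although \<open>e < 1\<close> when \<open>p > 2\<close>.\<close>

definition admissible :: "real \<Rightarrow> real \<Rightarrow> real \<Rightarrow> (real \<Rightarrow> real) \<Rightarrow> bool" where
  "admissible m d A u \<longleftrightarrow>
     continuous_on {0..1} u \<and> (\<forall>r\<in>{0..1}. u r \<le> A) \<and> (\<forall>r\<in>{0..d}. m \<le> u r)"

lemma J_nonneg: "continuous_on {0..1} u \<Longrightarrow> s \<in> {0..1} \<Longrightarrow> 0 \<le> J u s"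
  unfolding J_def
  by (intro integral_nonneg integrable_continuous_real scaled_cont F_cont)
     (auto intro!: mult_nonneg_nonneg F_nonneg mult_le_one)

lemma J_upper:
  assumes "continuous_on {0..1} u" "\<And>r. r \<in> {0..1} \<Longrightarrow> u r \<le> A" "0 \<le> A" "s \<in> {0..1}"
  shows "J u s \<le> b 0 * A powr q / n"
proof -
  have "F u r \<le> b 0 * A powr q" if "r \<in> {0..1}" for r
    unfolding F_def using that assms(2)[OF that] assms(3) q_gt_1 b_nonneg[of r] b_decreasing[of 0 r]
    by (intro mult_mono powr_mono2) auto
  then have "J u s \<le> integral {0..1} (\<lambda>t. t ^ (n - 1) * (b 0 * A powr q))"
    unfolding J_def using assms
    by (intro integral_le integrable_continuous_real scaled_cont F_cont continuous_intros mult_left_mono)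
       (auto simp: mult_le_one)
  also have "\<dots> = b 0 * A powr q / n" using integral_power_n[of 1] by simp
  finally show ?thesis .
qed

lemma J_lower:
  assumes u: "continuous_on {0..1} u" "\<And>r. r \<in> {0..d} \<Longrightarrow> m \<le> u r"
    and d: "0 < d" "d < 1" "0 < m" and s: "s \<in> {0..1}"
  shows "b d * m powr q * d ^ n / n \<le> J u s"
proof -
  have int: "(\<lambda>t. t ^ (n - 1) * F u (s * t)) integrable_on {0..1}"
    using u s by (intro integrable_continuous_real scaled_cont F_cont)
  have "b d * m powr q \<le> F u r" if "r \<in> {0..d}" for r
    unfolding F_def using that u(2)[OF that] d q_gt_1 b_nonneg[of r] b_decreasing[of r d]
    by (intro mult_mono powr_mono2) auto
  moreover have "s * t \<le> d" if "t \<in> {0..d}" for t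
    using that s mult_mono[of s 1 t d] by auto
  ultimately have "integral {0..d} (\<lambda>t. t ^ (n - 1) * (b d * m powr q))
      \<le> integral {0..d} (\<lambda>t. t ^ (n - 1) * F u (s * t))"
    using d s by (intro integral_le integrable_subinterval_real[OF int]
        integrable_continuous_real continuous_intros mult_left_mono) auto
  also have "\<dots> \<le> J u s"
    unfolding J_def using d s
    by (intro integral_subset_le int integrable_subinterval_real[OF int])
       (auto intro!: mult_nonneg_nonneg F_nonneg mult_le_one)
  also have "integral {0..d} (\<lambda>t. t ^ (n - 1) * (b d * m powr q)) = b d * m powr q * (d ^ n / n)"
    using d by (intro integral_power_n) auto
  finally show ?thesis by simp
qed

lemma flux_cont: "continuous_on {0..1} u \<Longrightarrow> continuous_on {0..1} (\<lambda>s. (s * J u s) powr e)"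
  using e_pos J_nonneg[of u]
  by (intro continuous_on_powr' continuous_intros J_cont) auto

lemma S_deriv:
  "continuous_on {0..1} u \<Longrightarrow> r \<in> {0..1} \<Longrightarrow>
    (S u has_real_derivative (r * J u r) powr e) (at r within {0..1})"
  unfolding S_def[abs_def] by (rule integral_has_real_derivative[OF flux_cont])

lemma S_cont: "continuous_on {0..1} u \<Longrightarrow> continuous_on {0..1} (S u)"
  using S_deriv by (rule DERIV_continuous_on)

lemma S_nonneg:
  assumes "continuous_on {0..1} u" "r \<in> {0..1}" shows "0 \<le> S u r"
  unfolding S_def using assms
  by (intro integral_nonneg integrable_continuous_real continuous_on_subset[OF flux_cont]) auto

text \<open>An upper bound for \<open>S u r\<close> over all \<open>u \<le> A\<close>, obtained from \<open>b \<le> b 0\<close>.\<close>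

definition S_bound :: "real \<Rightarrow> real \<Rightarrow> real" where
  "S_bound A r = r * (r * (b 0 * A powr q / n)) powr e"

lemma S_upper:
  assumes "continuous_on {0..1} u" "\<And>r. r \<in> {0..1} \<Longrightarrow> u r \<le> A" "0 \<le> A" "r \<in> {0..1}"
  shows "S u r \<le> S_bound A r"
proof -
  have "S u r \<le> integral {0..r} (\<lambda>s. (r * (b 0 * A powr q / n)) powr e)"
    unfolding S_def
  proof (intro integral_le integrable_continuous_real continuous_on_subset[OF flux_cont] continuous_intros)
    fix s assume s: "s \<in> {0..r}"
    show "(s * J u s) powr e \<le> (r * (b 0 * A powr q / n)) powr e"
      using s assms J_nonneg[OF assms(1), of s] J_upper[OF assms(1,2,3), of s] e_pos
      by (intro powr_mono2 mult_mono) auto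
  qed (use assms in auto)
  then show ?thesis using assms by (simp add: S_bound_def)
qed

text \<open>On functions with a common positive lower bound near the centre the power is not singular
in the unknown: \<open>(s J) powr e = s powr e * J powr e\<close>, and \<open>J\<close> stays in a compact subset of
\<open>(0,\<infinity>)\<close>. So \<open>S\<close> is a Volterra operator with bounded Lipschitz kernel, and in a norm weighted
by \<open>exp (- K r)\<close> with \<open>K\<close> large it contracts on the whole interval at once.\<close>

lemma S_contraction:
  assumes A: "0 \<le> A" and d: "0 < d" "d < 1" "0 < m"
  obtains K where "0 < K"
    "\<And>u v N r. admissible m d A u \<Longrightarrow> admissible m d A v \<Longrightarrow> 0 \<le> N \<Longrightarrow> r \<in> {0..1} \<Longrightarrow>
       (\<And>s. s \<in> {0..1} \<Longrightarrow> \<bar>u s - v s\<bar> \<le> N * exp (K * s)) \<Longrightarrow>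
       \<bar>S u r - S v r\<bar> \<le> N / 2 * exp (K * r)"
proof -
  define c where "c = b d * m powr q * d ^ n / n"
  define C where "C = b 0 * A powr q / n"
  have "0 < c" using d b_pos[of d] n_ge_1 by (simp add: c_def)
  then obtain L1 where L1: "0 \<le> L1"
    "\<And>x y. x \<in> {c..C} \<Longrightarrow> y \<in> {c..C} \<Longrightarrow> \<bar>x powr e - y powr e\<bar> \<le> L1 * \<bar>x - y\<bar>"
    using powr_lipschitz[of c C e] by auto
  obtain L2 where L2: "0 \<le> L2"
    "\<And>x y. x \<le> A \<Longrightarrow> y \<le> A \<Longrightarrow> \<bar>max x 0 powr q - max y 0 powr q\<bar> \<le> L2 * \<bar>x - y\<bar>"
    using pos_part_powr_lipschitz[OF q_gt_1 A] by auto
  define K where "K = 2 * (L1 * (b 0 * L2)) + 1"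
  have "0 \<le> L1 * (b 0 * L2)" using L1 L2 b_0_pos by simp
  then have K: "0 < K" "L1 * (b 0 * L2) \<le> K / 2" by (auto simp: K_def)
  show ?thesis
  proof (rule that[OF K(1)])
    fix u v :: "real \<Rightarrow> real" and N r :: real
    assume adm: "admissible m d A u" "admissible m d A v" and N: "0 \<le> N" and r: "r \<in> {0..1}"
      and uv: "\<And>s. s \<in> {0..1} \<Longrightarrow> \<bar>u s - v s\<bar> \<le> N * exp (K * s)"
    have cont: "continuous_on {0..1} u" "continuous_on {0..1} v"
      and le: "\<And>s. s \<in> {0..1} \<Longrightarrow> u s \<le> A" "\<And>s. s \<in> {0..1} \<Longrightarrow> v s \<le> A"
      using adm by (auto simp: admissible_def)
    have Jb: "J w s \<in> {c..C}" if "admissible m d A w" "s \<in> {0..1}" for w s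
      using J_lower[of w d m s] J_upper[of w A s] that d A
      by (auto simp: admissible_def c_def C_def)
    have Fd: "\<bar>F u s - F v s\<bar> \<le> b 0 * L2 * (N * exp (K * s))" if s: "s \<in> {0..1}" for s
    proof -
      have "\<bar>F u s - F v s\<bar> = b s * \<bar>max (u s) 0 powr q - max (v s) 0 powr q\<bar>"
        using b_nonneg[OF s] by (simp add: F_def abs_mult flip: right_diff_distrib)
      also have "\<dots> \<le> b 0 * (L2 * \<bar>u s - v s\<bar>)"
        using L2 le[OF s] b_nonneg[OF s] b_decreasing[of 0 s] s by (intro mult_mono) auto
      also have "\<dots> \<le> b 0 * (L2 * (N * exp (K * s)))"
        using uv[OF s] L2 b_0_pos by (intro mult_left_mono) auto
      finally show ?thesis by (simp add: mult_ac)
    qed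
    have Jd: "\<bar>J u s - J v s\<bar> \<le> b 0 * L2 * (N * exp (K * s))" if s: "s \<in> {0..1}" for s
    proof -
      have int: "(\<lambda>t. t ^ (n - 1) * F w (s * t)) integrable_on {0..1}" if "continuous_on {0..1} w" for w
        using that s by (intro integrable_continuous_real scaled_cont F_cont)
      have "\<bar>J u s - J v s\<bar> =
          norm (integral {0..1} (\<lambda>t. t ^ (n - 1) * F u (s * t) - t ^ (n - 1) * F v (s * t)))"
        unfolding J_def by (subst integral_diff[OF int int]) (auto simp: cont)
      also have "\<dots> \<le> integral {0..1::real} (\<lambda>t. b 0 * L2 * (N * exp (K * s)))"
      proof (intro integral_norm_bound_integral integrable_diff int cont)
        fix t :: real assume t: "t \<in> {0..1}"
        have st: "s * t \<in> {0..1}" "s * t \<le> s" using s t by (auto intro: mult_le_one mult_left_le)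
        have "norm (t ^ (n - 1) * F u (s * t) - t ^ (n - 1) * F v (s * t))
            = t ^ (n - 1) * \<bar>F u (s * t) - F v (s * t)\<bar>"
          using t by (simp add: abs_mult flip: right_diff_distrib)
        also have "\<dots> \<le> 1 * (b 0 * L2 * (N * exp (K * (s * t))))"
          using t Fd[OF st(1)] by (intro mult_mono power_le_one) auto
        also have "\<dots> \<le> b 0 * L2 * (N * exp (K * s))"
          using st N K L2 b_0_pos by (auto intro!: mult_left_mono)
        finally show "norm (t ^ (n - 1) * F u (s * t) - t ^ (n - 1) * F v (s * t))
            \<le> b 0 * L2 * (N * exp (K * s))" .
      qed auto
      finally show ?thesis by simp
    qed
    have int: "(\<lambda>s. (s * J w s) powr e) integrable_on {0..r}" if "continuous_on {0..1} w" for w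
      using r by (intro integrable_continuous_real continuous_on_subset[OF flux_cont[OF that]]) auto
    have "\<bar>S u r - S v r\<bar> =
        norm (integral {0..r} (\<lambda>s. (s * J u s) powr e - (s * J v s) powr e))"
      unfolding S_def by (subst integral_diff[OF int int]) (auto simp: cont)
    also have "\<dots> \<le> integral {0..r} (\<lambda>s. K / 2 * (N * exp (K * s)))"
    proof (intro integral_norm_bound_integral integrable_diff int cont)
      show "(\<lambda>s. K / 2 * (N * exp (K * s))) integrable_on {0..r}"
        by (intro integrable_continuous_real continuous_intros)
      fix s assume "s \<in> {0..r}"
      then have s: "s \<in> {0..1}" using r by auto
      have "norm ((s * J u s) powr e - (s * J v s) powr e) = s powr e * \<bar>J u s powr e - J v s powr e\<bar>"
        using s J_nonneg cont by (simp add: powr_mult abs_mult flip: right_diff_distrib)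
      also have "\<dots> \<le> 1 * (L1 * \<bar>J u s - J v s\<bar>)"
        using s e_pos L1 Jb[OF adm(1) s] Jb[OF adm(2) s] by (intro mult_mono powr_le1) auto
      also have "\<dots> \<le> L1 * (b 0 * L2 * (N * exp (K * s)))"
        using Jd[OF s] L1 by (simp add: mult_left_mono)
      also have "\<dots> \<le> K / 2 * (N * exp (K * s))"
        using mult_right_mono[OF K(2), of "N * exp (K * s)"] N by (simp add: mult_ac)
      finally show "norm ((s * J u s) powr e - (s * J v s) powr e) \<le> K / 2 * (N * exp (K * s))" .
    qed
    also have "integral {0..r} (\<lambda>s. K / 2 * (N * exp (K * s))) = N / 2 * exp (K * r) - N / 2 * exp (K * 0)"
    proof (intro integral_unique fundamental_theorem_of_calculus)
      show "((\<lambda>s. N / 2 * exp (K * s)) has_vector_derivative K / 2 * (N * exp (K * x))) (at x within {0..r})" for x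
        unfolding has_real_derivative_iff_has_vector_derivative[symmetric]
        by (auto intro!: derivative_eq_intros)
    qed (use r in auto)
    finally show "\<bar>S u r - S v r\<bar> \<le> N / 2 * exp (K * r)" using N by simp
  qed
qed

section \<open>Well-posedness of the initial value problem\<close>

definition solves :: "real \<Rightarrow> (real \<Rightarrow> real) \<Rightarrow> bool" where
  "solves a u \<longleftrightarrow> continuous_on {0..1} u \<and> (\<forall>r\<in>{0..1}. u r = a - S u r)"

lemma solves_upper: "solves a u \<Longrightarrow> r \<in> {0..1} \<Longrightarrow> u r \<le> a"
  using S_nonneg[of u r] by (auto simp: solves_def)

text \<open>Every solution with centre value in \<open>[a0,A]\<close> stays above \<open>a0 / 2\<close> on a common core
interval, since it can descend by at most \<open>S_bound A d\<close> there.\<close>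

lemma exists_core_radius:
  assumes "0 < a0" "a0 \<le> A"
  obtains d where "0 < d" "d < 1" "S_bound A d \<le> a0 / 2"
proof -
  have "continuous_on {0..1} (\<lambda>r. S_bound A r)"
    unfolding S_bound_def using b_0_pos e_pos by (intro continuous_intros continuous_on_powr') auto
  then have "(S_bound A \<longlongrightarrow> S_bound A 0) (at 0 within {0..1})"
    by (auto simp: continuous_on)
  then have "(S_bound A \<longlongrightarrow> 0) (at_right 0)"
    by (simp add: S_bound_def at_within_Icc_at_right)
  then have "eventually (\<lambda>r. S_bound A r < a0 / 2) (at_right 0)"
    using assms by (intro order_tendstoD) auto
  then obtain c where c: "0 < c" "\<And>r. 0 < r \<Longrightarrow> r < c \<Longrightarrow> S_bound A r < a0 / 2"
    unfolding eventually_at_right_field by auto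
  show ?thesis
    by (rule that[of "min c 1 / 2"]) (use c(1) c(2)[of "min c 1 / 2"] in \<open>auto simp: min_def\<close>)
qed

lemma S_bound_mono: "0 \<le> r \<Longrightarrow> r \<le> s \<Longrightarrow> S_bound A r \<le> S_bound A s"
  unfolding S_bound_def using b_0_pos e_pos
  by (intro mult_mono powr_mono2 mult_right_mono) auto

lemma admissible_step:
  assumes u: "continuous_on {0..1} u" "\<And>r. r \<in> {0..1} \<Longrightarrow> u r \<le> A"
    and a: "a0 \<le> a" "a \<le> A" "0 < a0" and d: "0 < d" "d < 1" "S_bound A d \<le> a0 / 2"
  shows "admissible (a0 / 2) d A (\<lambda>r. a - S u r)"
  unfolding admissible_def
proof (intro conjI ballI)
  show "continuous_on {0..1} (\<lambda>r. a - S u r)"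
    by (intro continuous_intros S_cont u)
  show "a - S u r \<le> A" if "r \<in> {0..1}" for r
    using S_nonneg[OF u(1) that] a by simp
  show "a0 / 2 \<le> a - S u r" if "r \<in> {0..d}" for r
    using S_upper[OF u, of r] S_bound_mono[of r d A] that a d by simp
qed

lemma solves_admissible:
  assumes "solves a u" "a0 \<le> a" "a \<le> A" "0 < a0" "0 < d" "d < 1" "S_bound A d \<le> a0 / 2"
  shows "admissible (a0 / 2) d A u"
proof -
  have c: "continuous_on {0..1} u" using assms by (auto simp: solves_def)
  have "u r \<le> A" if "r \<in> {0..1}" for r
    using solves_upper[OF assms(1) that] assms by simp
  then have "admissible (a0 / 2) d A (\<lambda>r. a - S u r)"
    using c assms by (intro admissible_step) auto
  then show ?thesis
    using assms c unfolding admissible_def solves_def by auto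
qed

text \<open>The weighted distance \<open>N\<close> of two solutions satisfies \<open>N \<le> \<bar>a - c\<bar> + N / 2\<close>, by the
contraction property.\<close>

lemma solves_continuous_dependence:
  assumes "0 < a0" "a0 \<le> A"
  obtains L where "0 \<le> L"
    "\<And>a c u v r. a \<in> {a0..A} \<Longrightarrow> c \<in> {a0..A} \<Longrightarrow> solves a u \<Longrightarrow> solves c v \<Longrightarrow> r \<in> {0..1} \<Longrightarrow>
       \<bar>u r - v r\<bar> \<le> L * \<bar>a - c\<bar>"
proof -
  obtain d where d: "0 < d" "d < 1" "S_bound A d \<le> a0 / 2" using exists_core_radius[OF assms] .
  obtain K where K: "0 < K"
    "\<And>u v N r. admissible (a0 / 2) d A u \<Longrightarrow> admissible (a0 / 2) d A v \<Longrightarrow> 0 \<le> N \<Longrightarrow> r \<in> {0..1} \<Longrightarrow>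
       (\<And>s. s \<in> {0..1} \<Longrightarrow> \<bar>u s - v s\<bar> \<le> N * exp (K * s)) \<Longrightarrow>
       \<bar>S u r - S v r\<bar> \<le> N / 2 * exp (K * r)"
    using S_contraction[of A d "a0 / 2"] assms d by auto
  show ?thesis
  proof (rule that[of "2 * exp K"])
    fix a c r :: real and u v :: "real \<Rightarrow> real"
    assume a: "a \<in> {a0..A}" "c \<in> {a0..A}" and sol: "solves a u" "solves c v" and r: "r \<in> {0..1}"
    have adm: "admissible (a0 / 2) d A u" "admissible (a0 / 2) d A v"
      using a sol assms d by (auto intro: solves_admissible)
    have cont: "continuous_on {0..1} (\<lambda>s. \<bar>u s - v s\<bar> * exp (- K * s))"
      using sol by (intro continuous_intros) (auto simp: solves_def)
    \<comment> \<open>the weighted distance of the two solutions is attained at \<open>z\<close>\<close>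
    obtain z where z: "z \<in> {0..1}"
      "\<And>s. s \<in> {0..1} \<Longrightarrow> \<bar>u s - v s\<bar> * exp (- K * s) \<le> \<bar>u z - v z\<bar> * exp (- K * z)"
      using continuous_attains_sup[OF _ _ cont] by fastforce
    define N where "N = \<bar>u z - v z\<bar> * exp (- K * z)"
    have N: "\<bar>u s - v s\<bar> \<le> N * exp (K * s)" if "s \<in> {0..1}" for s
    proof -
      have "\<bar>u s - v s\<bar> = \<bar>u s - v s\<bar> * exp (- K * s) * exp (K * s)"
        by (simp add: mult.assoc flip: exp_add)
      also have "\<dots> \<le> N * exp (K * s)" using z(2)[OF that] by (intro mult_right_mono) (auto simp: N_def)
      finally show ?thesis .
    qed
    have "\<bar>u z - v z\<bar> \<le> \<bar>a - c\<bar> + \<bar>S u z - S v z\<bar>"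
      using sol z(1) by (auto simp: solves_def)
    also have "\<dots> \<le> \<bar>a - c\<bar> + N / 2 * exp (K * z)"
      using K(2)[OF adm _ z(1) N] by (simp add: N_def)
    finally have "N \<le> (\<bar>a - c\<bar> + N / 2 * exp (K * z)) * exp (- K * z)"
      unfolding N_def by (intro mult_right_mono) auto
    also have "\<dots> = \<bar>a - c\<bar> * exp (- K * z) + N / 2"
      by (simp add: distrib_right flip: exp_add)
    also have "\<dots> \<le> \<bar>a - c\<bar> * 1 + N / 2"
      using K z by (intro add_right_mono mult_left_mono) auto
    finally have "N \<le> 2 * \<bar>a - c\<bar>" by simp
    have "\<bar>u r - v r\<bar> \<le> N * exp (K * r)" using N[OF r] .
    also have "\<dots> \<le> (2 * \<bar>a - c\<bar>) * exp K"
      using \<open>N \<le> 2 * \<bar>a - c\<bar>\<close> K r by (intro mult_mono) auto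
    finally show "\<bar>u r - v r\<bar> \<le> 2 * exp K * \<bar>a - c\<bar>" by (simp add: mult_ac)
  qed simp
qed

lemma solves_unique:
  assumes "0 < a" "solves a u" "solves a v" "r \<in> {0..1}" shows "u r = v r"
proof -
  obtain L where "\<And>u v r. solves a u \<Longrightarrow> solves a v \<Longrightarrow> r \<in> {0..1} \<Longrightarrow> \<bar>u r - v r\<bar> \<le> L * \<bar>a - a\<bar>"
    using solves_continuous_dependence[of a a] assms(1) by (metis atLeastAtMost_iff order_refl)
  from this[OF assms(2-)] show ?thesis by simp
qed

text \<open>Picard iteration, with geometric convergence in the weighted norm.\<close>

lemma solves_exists:
  assumes a: "0 < a"
  shows "\<exists>u. solves a u"
proof -
  obtain d where d: "0 < d" "d < 1" "S_bound a d \<le> a / 2" using exists_core_radius[of a a] a by auto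
  obtain K where K: "0 < K"
    "\<And>u v N r. admissible (a / 2) d a u \<Longrightarrow> admissible (a / 2) d a v \<Longrightarrow> 0 \<le> N \<Longrightarrow> r \<in> {0..1} \<Longrightarrow>
       (\<And>s. s \<in> {0..1} \<Longrightarrow> \<bar>u s - v s\<bar> \<le> N * exp (K * s)) \<Longrightarrow>
       \<bar>S u r - S v r\<bar> \<le> N / 2 * exp (K * r)"
    using S_contraction[of a d "a / 2"] a d by auto
  define T where "T = (\<lambda>u r. a - S u r)"
  define w where "w k = (T ^^ k) (\<lambda>_. a)" for k
  have w_Suc: "w (Suc k) r = a - S (w k) r" for k r by (simp add: w_def T_def)
  have adm: "admissible (a / 2) d a (w k)" for k
  proof (induction k)
    case 0 then show ?case using a by (simp add: w_def admissible_def)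
  next
    case (Suc k)
    then have "continuous_on {0..1} (w k)" "\<And>r. r \<in> {0..1} \<Longrightarrow> w k r \<le> a"
      by (auto simp: admissible_def)
    then have "admissible (a / 2) d a (\<lambda>r. a - S (w k) r)"
      using a d by (intro admissible_step) auto
    then show ?case by (simp add: w_def T_def)
  qed
  have cont: "continuous_on {0..1} (w k)" and w_le: "r \<in> {0..1} \<Longrightarrow> w k r \<le> a" for k r
    using adm[of k] by (auto simp: admissible_def)
  define M where "M = S_bound a 1"
  have M: "0 \<le> M" using b_0_pos by (simp add: M_def S_bound_def)
  have step: "\<bar>w (Suc k) r - w k r\<bar> \<le> M / 2 ^ k * exp (K * r)" if "r \<in> {0..1}" for k r
    using that
  proof (induction k arbitrary: r)
    case 0
    have "\<bar>w (Suc 0) r - w 0 r\<bar> = S (w 0) r"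
      using S_nonneg[OF cont 0, of 0] by (simp add: w_Suc) (simp add: w_def)
    also have "\<dots> \<le> M * 1"
      using S_upper[OF cont[of 0] w_le, of r] S_bound_mono[of r 1 a] 0 a by (simp add: M_def)
    also have "\<dots> \<le> M * exp (K * r)"
      using M K 0 by (intro mult_left_mono) auto
    finally show ?case by simp
  next
    case (Suc k)
    have "\<bar>w (Suc (Suc k)) r - w (Suc k) r\<bar> = \<bar>S (w (Suc k)) r - S (w k) r\<bar>"
      by (simp add: w_Suc abs_minus_commute)
    also have "\<dots> \<le> (M / 2 ^ k) / 2 * exp (K * r)"
      using M Suc.IH by (intro K(2) adm Suc.prems) auto
    finally show ?case by (simp add: field_simps)
  qed
  define B where "B k = M * exp K * (1 / 2) ^ k" for k :: nat
  have stepB: "norm (w (Suc k) r - w k r) \<le> B k" if "r \<in> {0..1}" for k r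
  proof -
    have "M / 2 ^ k * exp (K * r) \<le> M / 2 ^ k * exp K"
      using M K that by (intro mult_left_mono) auto
    then show ?thesis using step[OF that, of k] by (simp add: B_def power_one_over field_simps)
  qed
  have "uniform_limit {0..1} (\<lambda>k r. \<Sum>i<k. w (Suc i) r - w i r) (\<lambda>r. \<Sum>i. w (Suc i) r - w i r) sequentially"
  proof (rule Weierstrass_m_test[OF stepB])
    show "summable B" unfolding B_def by (intro summable_mult summable_geometric) auto
  qed
  moreover have eq: "(\<lambda>k r. \<Sum>i<k. w (Suc i) r - w i r) = (\<lambda>k r. w k r - a)"
  proof (intro ext)
    show "(\<Sum>i<k. w (Suc i) r - w i r) = w k r - a" for k r
      using sum_lessThan_telescope[of "\<lambda>i. w i r" k] by (simp add: w_def)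
  qed
  ultimately have "uniform_limit {0..1} (\<lambda>k r. w k r - a) (\<lambda>r. \<Sum>i. w (Suc i) r - w i r) sequentially"
    by simp
  from uniform_limit_add[OF this uniform_limit_const[where c = "\<lambda>_. a"]]
  obtain u where lim: "uniform_limit {0..1} w u sequentially" by auto
  have u_cont: "continuous_on {0..1} u"
    by (rule uniform_limit_theorem[OF _ lim]) (auto simp: cont)
  have ptw: "(\<lambda>k. w k r) \<longlonglongrightarrow> u r" if "r \<in> {0..1}" for r
    using tendsto_uniform_limitI[OF lim that] .
  have u_adm: "admissible (a / 2) d a u"
    unfolding admissible_def
  proof (intro conjI ballI u_cont)
    show "u r \<le> a" if "r \<in> {0..1}" for r
      using w_le[OF that] by (intro tendsto_upperbound[OF ptw[OF that]]) auto
    show "a / 2 \<le> u r" if "r \<in> {0..d}" for r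
    proof (rule tendsto_lowerbound[OF ptw])
      show "eventually (\<lambda>k. a / 2 \<le> w k r) sequentially"
        using adm that by (auto simp: admissible_def)
    qed (use that d in auto)
  qed
  have "u r = a - S u r" if r: "r \<in> {0..1}" for r
  proof -
    have "(\<lambda>k. S (w k) r) \<longlonglongrightarrow> S u r"
    proof (rule LIMSEQ_I)
      fix \<epsilon> :: real assume \<epsilon>: "0 < \<epsilon>"
      define N where "N = \<epsilon> / exp K"
      have N: "0 < N" using \<epsilon> by (simp add: N_def)
      obtain k0 where k0: "\<And>k s. k \<ge> k0 \<Longrightarrow> s \<in> {0..1} \<Longrightarrow> \<bar>w k s - u s\<bar> < N"
        using uniform_limitD[OF lim N] unfolding eventually_sequentially dist_real_def by metis
      have "norm (S (w k) r - S u r) < \<epsilon>" if k: "k \<ge> k0" for k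
      proof -
        have "\<bar>w k s - u s\<bar> \<le> N * exp (K * s)" if s: "s \<in> {0..1}" for s
        proof -
          have "\<bar>w k s - u s\<bar> \<le> N * 1" using k0[OF k s] by simp
          also have "\<dots> \<le> N * exp (K * s)" using N K s by (intro mult_left_mono) auto
          finally show ?thesis .
        qed
        then have "\<bar>S (w k) r - S u r\<bar> \<le> N / 2 * exp (K * r)"
          using N by (intro K(2) adm u_adm r) auto
        also have "\<dots> \<le> N / 2 * exp K" using N K r by (intro mult_left_mono) auto
        also have "\<dots> < \<epsilon>" using \<epsilon> by (simp add: N_def)
        finally show ?thesis by simp
      qed
      then show "\<exists>k0. \<forall>k\<ge>k0. norm (S (w k) r - S u r) < \<epsilon>" by blast
    qed
    then have "(\<lambda>k. w (Suc k) r) \<longlonglongrightarrow> a - S u r"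
      unfolding w_Suc by (intro tendsto_intros)
    moreover have "(\<lambda>k. w (Suc k) r) \<longlonglongrightarrow> u r"
      using ptw[OF r] by (rule LIMSEQ_Suc)
    ultimately show ?thesis using LIMSEQ_unique by blast
  qed
  with u_cont show ?thesis by (auto simp: solves_def)
qed

section \<open>Positive solutions are zeros of the shooting map\<close>

text \<open>Along a solution this is \<open>- \<phi>(u')\<close>.\<close>

definition flux :: "(real \<Rightarrow> real) \<Rightarrow> real \<Rightarrow> real" where
  "flux u r = r * J u r"

lemma solves_0: "solves a u \<Longrightarrow> u 0 = a"
  by (simp add: solves_def S_def)

lemma solves_deriv:
  assumes "solves a u" "r \<in> {0..1}"
  shows "(u has_real_derivative - (flux u r powr e)) (at r within {0..1})"
proof -
  have "((\<lambda>r. a - S u r) has_real_derivative - (flux u r powr e)) (at r within {0..1})"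
    unfolding flux_def using assms by (auto simp: solves_def intro!: derivative_eq_intros S_deriv)
  then show ?thesis
    by (rule has_field_derivative_transform_within[where d = 1]) (use assms in \<open>auto simp: solves_def\<close>)
qed

lemma J_pos:
  assumes "solves a u" "0 < a" "r \<in> {0..1}" shows "0 < J u r"
proof -
  obtain d where d: "0 < d" "d < 1" "S_bound a d \<le> a / 2" using exists_core_radius[of a a] assms by auto
  have "admissible (a / 2) d a u" using assms d by (intro solves_admissible[of a]) auto
  then have "b d * (a / 2) powr q * d ^ n / n \<le> J u r"
    using d assms by (intro J_lower) (auto simp: admissible_def)
  moreover have "0 < b d * (a / 2) powr q * d ^ n / n"
    using d assms b_pos[of d] n_ge_1 by simp
  ultimately show ?thesis by linarith
qed

lemma flux_pos: "solves a u \<Longrightarrow> 0 < a \<Longrightarrow> r \<in> {0<..1} \<Longrightarrow> 0 < flux u r"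
  unfolding flux_def using J_pos[of a u r] by auto

lemma mass_deriv:
  assumes "continuous_on {0..1} u" "r \<in> {0..1}"
  shows "((\<lambda>r. r ^ n * J u r) has_real_derivative r ^ (n - 1) * F u r) (at r within {0..1})"
proof -
  have "((\<lambda>r. integral {0..r} (\<lambda>t. t ^ (n - 1) * F u t)) has_real_derivative r ^ (n - 1) * F u r)
      (at r within {0..1})"
    by (rule integral_has_real_derivative) (use assms in \<open>auto intro!: continuous_intros F_cont\<close>)
  then show ?thesis
    by (rule has_field_derivative_transform_within[where d = 1]) (use assms J_scaled in auto)
qed

lemma power_pred_deriv:
  fixes r :: real
  assumes "r \<noteq> 0"
  shows "((\<lambda>r. r ^ (n - 1)) has_real_derivative (real n - 1) / r * r ^ (n - 1)) (at r within X)"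
proof -
  have "(real n - 1) / r * r ^ (n - 1) = (real n - 1) * r ^ (n - 1 - 1)"
    using assms n_ge_1 by (cases "n - 1") (auto simp: of_nat_diff)
  then show ?thesis using n_ge_1 by (auto intro!: derivative_eq_intros simp: of_nat_diff)
qed

lemma power_n: "r ^ n = r * r ^ (n - 1)" for r :: real
  using n_ge_1 by (cases n) auto

lemma flux_deriv:
  assumes "continuous_on {0..1} u" "r \<in> {0<..1}"
  shows "(flux u has_real_derivative F u r - (real n - 1) / r * flux u r) (at r within {0<..1})"
proof -
  define g R where "g r = r ^ n * J u r" and "R r = r ^ (n - 1)" for r
  have R: "R r \<noteq> 0" "(R has_real_derivative (real n - 1) / r * R r) (at r within {0<..1})"
    using assms power_pred_deriv[of r] by (auto simp: R_def[abs_def])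
  have g: "(g has_real_derivative R r * F u r) (at r within {0<..1})"
    unfolding g_def R_def
    by (rule has_field_derivative_subset[OF mass_deriv]) (use assms in auto)
  have "((\<lambda>r. g r / R r) has_real_derivative
      (R r * F u r * R r - g r * ((real n - 1) / r * R r)) / (R r * R r)) (at r within {0<..1})"
    by (intro DERIV_divide g R)
  moreover have "(R r * F u r * R r - g r * ((real n - 1) / r * R r)) / (R r * R r)
      = F u r - (real n - 1) / r * flux u r"
  proof -
    have "g r = r * R r * J u r" by (simp only: g_def power_n R_def)
    then show ?thesis using R(1) assms by (simp add: flux_def field_simps)
  qed
  ultimately have "((\<lambda>r. g r / R r) has_real_derivative F u r - (real n - 1) / r * flux u r)
      (at r within {0<..1})" by simp
  then show ?thesis
    by (rule has_field_derivative_transform_within[where d = 1])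
       (use assms power_n in \<open>auto simp: flux_def g_def R_def\<close>)
qed

lemma at_within_Ioc_interior: "0 < r \<Longrightarrow> r < 1 \<Longrightarrow> at r within {0<..1} = at (r::real)"
  by (rule at_within_open_subset[of r "{0<..<1}"]) auto

lemma solves_deriv_at:
  "solves a u \<Longrightarrow> 0 < r \<Longrightarrow> r < 1 \<Longrightarrow> (u has_real_derivative - (flux u r powr e)) (at r)"
  using solves_deriv[of a u r] by (simp add: at_within_Icc_at)

lemma flux_deriv_at:
  "solves a u \<Longrightarrow> 0 < r \<Longrightarrow> r < 1 \<Longrightarrow>
    (flux u has_real_derivative F u r - (real n - 1) / r * flux u r) (at r)"
  using flux_deriv[of u r] at_within_Ioc_interior[of r] by (simp add: solves_def)

lemma solves_decreasing:
  assumes "solves a u" "0 < a" "0 \<le> r" "r < s" "s \<le> 1"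
  shows "u s < u r"
proof (rule DERIV_neg_imp_decreasing_open[OF assms(4)])
  show "continuous_on {r..s} u"
    using assms by (auto simp: solves_def intro: continuous_on_subset)
  show "\<exists>y. (u has_real_derivative y) (at x) \<and> y < 0" if "r < x" "x < s" for x
    using that assms solves_deriv_at[OF assms(1), of x] flux_pos[OF assms(1,2), of x] by fastforce
qed

lemma solves_pos:
  assumes "solves a u" "0 < a" "0 \<le> u 1" "0 \<le> r" "r < 1" shows "0 < u r"
  using solves_decreasing[OF assms(1,2,4,5)] assms(3) by simp

text \<open>In this form it is visible that \<open>\<phi>\<close> is continuous and how it inverts on the negative
half-line.\<close>

lemma phi_eq: "phi p t = max t 0 powr (p - 1) - max (- t) 0 powr (p - 1)"
proof (cases t "0::real" rule: linorder_cases)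
  case less
  have "(- t) powr (p - 1) = (- t) powr (p - 2) * (- t)"
    using less powr_add[of "- t" "p - 2" 1] by simp
  then show ?thesis using less p_gt_1 by (simp add: phi_def)
next
  case greater
  have "t powr (p - 1) = t powr (p - 2) * t"
    using greater powr_add[of t "p - 2" 1] by simp
  then show ?thesis using greater p_gt_1 by (simp add: phi_def)
qed (simp add: phi_def)

lemma phi_cont: "continuous_on X (phi p)"
  unfolding phi_eq[abs_def] using p_gt_1
  by (intro continuous_intros continuous_on_powr') auto

lemma phi_neg_powr: "0 \<le> y \<Longrightarrow> phi p (- (y powr e)) = - y"
  using p_gt_1 by (auto simp: phi_eq powr_powr e_def)

lemma phi_eq_neg:
  assumes "phi p t = - y" "0 \<le> y" shows "t = - (y powr e)"
proof (cases "t > 0")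
  case True
  then have "0 < phi p t" by (simp add: phi_def)
  then show ?thesis using assms by simp
next
  case False
  then have "y = (- t) powr (p - 1)" using assms p_gt_1 by (auto simp: phi_eq)
  then have "y powr e = (- t) powr 1" using p_gt_1 by (simp add: powr_powr e_def)
  then show ?thesis using False by simp
qed

text \<open>Integrating the divergence form from the centre, where the boundary term vanishes,
identifies \<open>\<phi>(u')\<close> with \<open>- r J(r)\<close>; hence \<open>u + S u\<close> has derivative 0.\<close>

lemma positive_solution_solves:
  assumes "positive_solution n p q b u"
  shows "solves (u 0) u" "0 < u 0" "u 1 = 0"
proof -
  obtain u' w where
    u: "\<And>x. x \<in> {0..1} \<Longrightarrow> (u has_real_derivative u' x) (at x within {0..1})"
    and u': "continuous_on {0..1} u'"
    and w: "\<And>x. x \<in> {0<..1} \<Longrightarrow> ((\<lambda>r. phi p (u' r)) has_real_derivative w x) (at x within {0<..1})"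
    and eq: "\<And>r. r \<in> {0<..<1} \<Longrightarrow> w r + (real n - 1) / r * phi p (u' r) + b r * u r powr q = 0"
    and bc: "u' 0 = 0" "u 1 = 0" and pos: "\<And>r. r \<in> {0..<1} \<Longrightarrow> 0 < u r"
    using assms unfolding positive_solution_def has_C1_derivative_on_def by blast
  have cont: "continuous_on {0..1} u" using u by (rule DERIV_continuous_on)
  define m where "m r = - (r ^ (n - 1) * phi p (u' r))" for r
  have m_int: "m r = r ^ n * J u r" if r: "r \<in> {0..1}" for r
  proof -
    have "((\<lambda>t. t ^ (n - 1) * F u t) has_integral (m r - m 0)) {0..r}"
    proof (rule fundamental_theorem_of_calculus_interior)
      have "continuous_on {0..1} m"
        unfolding m_def by (intro continuous_intros continuous_on_compose2[OF phi_cont u']) auto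
      then show "continuous_on {0..r} m" using r by (auto intro: continuous_on_subset)
      show "(m has_vector_derivative x ^ (n - 1) * F u x) (at x)" if x: "x \<in> {0<..<r}" for x
      proof -
        define R where "R r = r ^ (n - 1)" for r :: real
        have dw: "((\<lambda>r. phi p (u' r)) has_real_derivative w x) (at x)"
          using w[of x] x r at_within_Ioc_interior[of x] by simp
        have dR: "(R has_real_derivative (real n - 1) / x * R x) (at x)"
          using power_pred_deriv[of x UNIV] x by (auto simp: R_def[abs_def])
        have "(m has_real_derivative - ((real n - 1) / x * R x * phi p (u' x) + w x * R x)) (at x)"
          unfolding m_def R_def[symmetric] by (intro DERIV_minus DERIV_mult dw dR)
        moreover have alg: "- (A * R * h + c * R) = - R * (c + A * h + B) + R * B" for A R h c B :: real
          by (simp add: algebra_simps)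
        have "- ((real n - 1) / x * R x * phi p (u' x) + w x * R x)
            = - R x * (w x + (real n - 1) / x * phi p (u' x) + b x * u x powr q) + R x * (b x * u x powr q)"
          by (rule alg)
        moreover have "F u x = b x * u x powr q" using pos[of x] x r by (simp add: F_def)
        ultimately show ?thesis
          using eq[of x] x r by (simp add: R_def has_real_derivative_iff_has_vector_derivative)
      qed
    qed (use r in auto)
    moreover have "m 0 = 0" using bc by (simp add: m_def phi_def)
    ultimately show ?thesis using J_scaled[OF cont r] by (simp add: integral_unique)
  qed
  have u'_eq: "u' r = - ((r * J u r) powr e)" if r: "r \<in> {0..1}" for r
  proof (cases "r = 0")
    case False
    then have "phi p (u' r) = - (r * J u r)"
    proof -
      have "r ^ (n - 1) * phi p (u' r) = r ^ (n - 1) * (- (r * J u r))"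
        using m_int[OF r] unfolding m_def power_n[of r]
        by (metis minus_minus mult.assoc mult.commute mult_minus_right)
      then show ?thesis using False by (metis mult_cancel_left power_not_zero)
    qed
    then show ?thesis using r J_nonneg[OF cont r] by (intro phi_eq_neg) auto
  qed (use bc in auto)
  have "u r = u 0 - S u r" if r: "r \<in> {0..1}" for r
  proof -
    have "((\<lambda>r. u r + S u r) has_real_derivative 0) (at x within {0..1})" if "x \<in> {0..1}" for x
      using u[OF that] u'_eq[OF that] S_deriv[OF cont that]
      by (auto intro!: derivative_eq_intros)
    then have "u r + S u r = u 0 + S u 0"
      using r by (intro has_derivative_zero_unique[where s = "{0..1}" and f = "\<lambda>r. u r + S u r"])
        (auto simp: has_field_derivative_def lambda_zero)
    then show ?thesis by (simp add: S_def)
  qed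
  then show "solves (u 0) u" unfolding solves_def using cont by blast
  show "0 < u 0" "u 1 = 0" using pos[of 0] bc by auto
qed

lemma solves_positive_solution:
  assumes sol: "solves a u" and a: "0 < a" and u1: "u 1 = 0"
  shows "positive_solution n p q b u"
proof -
  have cont: "continuous_on {0..1} u" using sol by (simp add: solves_def)
  have pos: "0 < u r" if "r \<in> {0..<1}" for r
    using solves_pos[OF sol a] u1 that by simp
  define u' where "u' r = - (flux u r powr e)" for r
  define w where "w r = - (F u r - (real n - 1) * J u r)" for r
  have "continuous_on {0..1} u'"
    unfolding u'_def flux_def by (intro continuous_on_minus flux_cont cont)
  then have 1: "has_C1_derivative_on u u' {0..1}"
    unfolding has_C1_derivative_on_def u'_def using solves_deriv[OF sol] by auto
  have phi_u': "phi p (u' r) = - flux u r" if "r \<in> {0..1}" for r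
    unfolding u'_def using that J_nonneg[OF cont that] by (intro phi_neg_powr) (auto simp: flux_def)
  have "continuous_on {0<..1} w"
    unfolding w_def
    by (rule continuous_on_subset[of "{0..1}"]) (auto intro!: continuous_intros F_cont J_cont cont)
  moreover have "((\<lambda>r. phi p (u' r)) has_real_derivative w r) (at r within {0<..1})"
    if r: "r \<in> {0<..1}" for r
  proof -
    have "((\<lambda>r. - flux u r) has_real_derivative w r) (at r within {0<..1})"
      using DERIV_minus[OF flux_deriv[OF cont r]] r by (simp add: w_def flux_def)
    then show ?thesis
      by (rule has_field_derivative_transform_within[where d = 1]) (use r phi_u' in auto)
  qed
  ultimately have 2: "has_C1_derivative_on (\<lambda>r. phi p (u' r)) w {0<..1}"
    by (simp add: has_C1_derivative_on_def)
  have 3: "w r + (real n - 1) / r * phi p (u' r) + b r * u r powr q = 0" if "r \<in> {0<..<1}" for r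
    using that phi_u'[of r] pos[of r] by (simp add: w_def F_def flux_def)
  show ?thesis
    unfolding positive_solution_def
    using 1 2 3 u1 pos by (intro conjI exI[of _ u'] exI[of _ w]) (auto simp: u'_def flux_def)
qed

section \<open>The Pohozaev function\<close>

definition C0 :: real where "C0 = real n - (real n - p) * (q + 1) / p"

definition pohozaev :: "(real \<Rightarrow> real) \<Rightarrow> real \<Rightarrow> real" where
  "pohozaev u r =
     r ^ n * ((p - 1) / p * flux u r powr (1 + e) + b r * u r powr (q + 1) / (q + 1))
     - (real n - p) / p * u r * (r ^ n * J u r)"

text \<open>All terms without the source cancel: the coefficient of \<open>r^(n-1) y powr (1 + e)\<close> is
\<open>n (p - 1) / p - (n - 1) + (n - p) / p = 0\<close>. What is left has the sign of \<open>C0 + r b' / b\<close>.\<close>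

lemma pohozaev_deriv:
  assumes sol: "solves a u" "0 < a" and r: "0 < r" "r < 1" and u: "0 < u r"
  shows "(pohozaev u has_real_derivative
    r ^ (n - 1) * (b r * u r powr (q + 1) / (q + 1)) * (C0 + r * b' r / b r)) (at r)"
proof -
  define R where "R = r ^ (n - 1)"
  define y where "y = flux u r"
  define m where "m r = r ^ n * J u r" for r
  have y: "0 < y" using flux_pos[OF sol, of r] r by (simp add: y_def)
  have cont: "continuous_on {0..1} u" using sol by (simp add: solves_def)
  have F: "F u r = b r * u r powr q" using u by (simp add: F_def)
  have powers: "y powr (1 + e) = y * y powr e" "u r powr (q + 1) = u r * u r powr q"
    using y u by (simp_all add: powr_add)
  have dm: "(m has_real_derivative R * (b r * u r powr q)) (at r)"
    using mass_deriv[OF cont, of r] r F by (simp add: m_def[abs_def] R_def at_within_Icc_at)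
  have du: "(u has_real_derivative - (y powr e)) (at r)"
    using solves_deriv_at[OF sol(1) r] by (simp add: y_def)
  have dy: "(flux u has_real_derivative b r * u r powr q - (real n - 1) / r * y) (at r)"
    using flux_deriv_at[OF sol(1) r] F by (simp add: y_def)
  have dr: "((\<lambda>r. r ^ n) has_real_derivative real n * R) (at r)"
    by (auto intro!: derivative_eq_intros simp: R_def)
  have dY: "((\<lambda>r. flux u r powr (1 + e)) has_real_derivative
      (1 + e) * y powr e * (b r * u r powr q - (real n - 1) / r * y)) (at r)"
    using DERIV_chain2[OF has_real_derivative_powr[of "flux u r" "1 + e"] dy] y by (simp add: y_def)
  have dU: "((\<lambda>r. u r powr (q + 1)) has_real_derivative
      (q + 1) * u r powr q * (- (y powr e))) (at r)"
    using DERIV_chain2[OF has_real_derivative_powr[of "u r" "q + 1"] du] u by simp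
  have b0: "b r \<noteq> 0" using b_pos[OF r] by simp
  have mr: "m r = R * y" using power_n[of r] by (simp add: m_def R_def y_def flux_def)
  have pe: "(p - 1) / p * (1 + e) = 1" using p_gt_1 by (simp add: e_def field_simps)
  define Y U where "Y = y powr e" and "U = u r powr q"
  have "((\<lambda>r. r ^ n * ((p - 1) / p * flux u r powr (1 + e) + b r * u r powr (q + 1) / (q + 1))
      - (real n - p) / p * u r * m r) has_real_derivative
      real n * R * ((p - 1) / p * (y * Y) + b r * (u r * U) / (q + 1))
      + ((p - 1) / p * ((1 + e) * Y * (b r * U - (real n - 1) / r * y))
         + (b' r * (u r * U) + (q + 1) * U * (- Y) * b r) / (q + 1)) * r ^ n
      - ((real n - p) / p * (- Y) * m r + R * (b r * U) * ((real n - p) / p * u r))) (at r)"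
    by (rule DERIV_cong[OF DERIV_diff[OF DERIV_mult[OF dr DERIV_add[OF DERIV_cmult[OF dY]
          DERIV_cdivide[OF DERIV_mult[OF b_at[OF r] dU]]]] DERIV_mult[OF DERIV_cmult[OF du] dm]]])
       (simp add: Y_def U_def powers(2) powers(1)[unfolded y_def] y_def)
  moreover have "real n * R * ((p - 1) / p * (y * Y) + b r * (u r * U) / (q + 1))
      + ((p - 1) / p * ((1 + e) * Y * (b r * U - (real n - 1) / r * y))
         + (b' r * (u r * U) + (q + 1) * U * (- Y) * b r) / (q + 1)) * r ^ n
      - ((real n - p) / p * (- Y) * m r + R * (b r * U) * ((real n - p) / p * u r))
      = R * (b r * (u r * U) / (q + 1)) * (C0 + r * b' r / b r)"
  proof -
    have "(p - 1) / p * ((1 + e) * Y * (b r * U - (real n - 1) / r * y))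
      = (p - 1) / p * (1 + e) * (Y * (b r * U - (real n - 1) / r * y))" by (simp only: mult.assoc)
    then have eq: "(p - 1) / p * ((1 + e) * Y * (b r * U - (real n - 1) / r * y))
      = Y * (b r * U - (real n - 1) / r * y)" by (simp only: pe mult_1)
    have rn: "r ^ n = r * R" using power_n[of r] by (simp add: R_def)
    define Q where "Q = q + 1"
    have "Q \<noteq> 0" using q_gt_1 by (simp add: Q_def)
    then show ?thesis
      unfolding eq rn mr C0_def Q_def[symmetric] using b0 r p_gt_1 by (simp add: field_simps)
  qed
  ultimately show ?thesis
    unfolding pohozaev_def m_def[symmetric] by (simp add: powers(2) R_def U_def)
qed

lemma pohozaev_cont:
  assumes "solves a u" "0 < a" "0 \<le> u 1"
  shows "continuous_on {0..1} (pohozaev u)"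
proof -
  have cont: "continuous_on {0..1} u" using assms by (simp add: solves_def)
  have u: "0 \<le> u r" if "r \<in> {0..1}" for r
    using solves_pos[OF assms, of r] assms(3) that by (cases "r = 1") auto
  have J: "0 \<le> r * J u r" if "r \<in> {0..1}" for r
    using J_nonneg[OF cont that] that by auto
  have cy: "continuous_on {0..1} (flux u)"
    unfolding flux_def[abs_def] by (intro continuous_intros J_cont cont)
  have "continuous_on {0..1} (\<lambda>r. flux u r powr (1 + e))"
    by (rule continuous_on_powr'[OF cy]) (use J e_pos in \<open>auto simp: flux_def\<close>)
  moreover have "continuous_on {0..1} (\<lambda>r. u r powr (q + 1))"
    by (rule continuous_on_powr'[OF cont]) (use u q_gt_1 in auto)
  ultimately show ?thesis
    unfolding pohozaev_def using q_gt_1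
    by (intro continuous_on_diff continuous_on_mult continuous_on_add continuous_on_divide
        continuous_on_power continuous_on_const continuous_on_id cont J_cont b_cont) auto
qed

lemma pohozaev_0: "pohozaev u 0 = 0"
  using n_ge_1 by (simp add: pohozaev_def power_0_left)

section \<open>Shooting: existence\<close>

definition \<kappa> :: real where "\<kappa> = q - p + 1"

lemma \<kappa>_pos: "0 < \<kappa>" using q_gt by (simp add: \<kappa>_def)

lemma \<kappa>_e: "\<kappa> * e = q * e - 1"
proof -
  have "(p - 1) * e = 1" using p_gt_1 by (simp add: e_def)
  moreover have "\<kappa> * e = q * e - (p - 1) * e" by (simp add: \<kappa>_def algebra_simps)
  ultimately show ?thesis by simp
qed

lemma C0_pos: "0 < C0" using subcritical by (simp add: C0_def)

lemma log_slope_tendsto_0: "((\<lambda>r. r * b' r / b r) \<longlongrightarrow> 0) (at_right 0)"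
proof -
  have lim: "(f \<longlongrightarrow> f 0) (at_right 0)" if "continuous_on {0..1} f" for f :: "real \<Rightarrow> real"
    using that by (auto simp: continuous_on simp flip: at_within_Icc_at_right[of 0 1])
  have "((\<lambda>r. r * b' r / b r) \<longlongrightarrow> 0 * b' 0 / b 0) (at_right 0)"
    using b_0_pos by (intro tendsto_intros lim b'_cont b_cont) auto
  then show ?thesis by simp
qed

text \<open>The descent over \<open>[0,1]\<close> is at most a constant times \<open>a powr (q * e)\<close>, and
\<open>q * e > 1\<close>; the chosen \<open>a\<close> makes this bound equal to \<open>a / 2\<close>.\<close>

lemma solves_small:
  obtains a where "0 < a" "\<And>u. solves a u \<Longrightarrow> 0 < u 1"
proof -
  define B where "B = (b 0 / n) powr e"
  have B: "0 < B" using b_0_pos n_ge_1 by (simp add: B_def)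
  define a where "a = (1 / (2 * B)) powr (1 / (\<kappa> * e))"
  have a: "0 < a" using B by (simp add: a_def)
  have "a powr (q * e) = a powr (1 + \<kappa> * e)" using \<kappa>_e by simp
  also have "\<dots> = a * (1 / (2 * B))"
    using a B \<kappa>_pos e_pos by (simp add: powr_add a_def powr_powr)
  finally have aq: "a powr (q * e) = a * (1 / (2 * B))" .
  have "S_bound a 1 = B * a powr (q * e)"
    using b_0_pos a n_ge_1 by (simp add: S_bound_def B_def powr_mult powr_powr powr_divide)
  then have Sb: "S_bound a 1 = a / 2" using aq B by simp
  show ?thesis
  proof (rule that[OF a])
    fix u assume sol: "solves a u"
    have "S u 1 \<le> S_bound a 1"
      using sol a by (intro S_upper solves_upper[OF sol]) (auto simp: solves_def)
    then show "0 < u 1" using sol Sb a by (auto simp: solves_def)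
  qed
qed

lemma J_ge:
  assumes "continuous_on {0..1} u" "r \<in> {0..1}" "\<And>t. t \<in> {0..r} \<Longrightarrow> f \<le> F u t"
  shows "f / n \<le> J u r"
proof -
  have "integral {0..1} (\<lambda>t. t ^ (n - 1) * f) \<le> J u r"
    unfolding J_def
  proof (rule integral_le)
    show "(\<lambda>t. t ^ (n - 1) * f) integrable_on {0..1}"
      by (intro integrable_continuous_real continuous_intros)
    show "(\<lambda>t. t ^ (n - 1) * F u (r * t)) integrable_on {0..1}"
      using assms by (intro integrable_continuous_real scaled_cont F_cont)
    show "t ^ (n - 1) * f \<le> t ^ (n - 1) * F u (r * t)" if "t \<in> {0..1}" for t
      using that assms(2) by (intro mult_left_mono assms(3)) (auto intro: mult_left_le)
  qed
  then show ?thesis using integral_power_n[of 1 f] by simp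
qed

text \<open>A large positive solution must decay fast: since \<open>u\<close> decreases, its flux at \<open>r\<close> is at
least \<open>r / n * b(R) * u(r)^q\<close>, so that \<open>- u' \<ge> const * u powr (q * e)\<close> on \<open>[R/2,R]\<close>. As
\<open>q * e = 1 + \<kappa> * e > 1\<close>, the function \<open>u powr (- \<kappa> * e)\<close> grows at a rate bounded below,
whatever the centre value.\<close>

lemma a_priori_bound:
  assumes R: "0 < R" "R < 1"
  obtains U where "0 < U"
    "\<And>a u. solves a u \<Longrightarrow> 0 < a \<Longrightarrow> 0 \<le> u 1 \<Longrightarrow> u R \<le> U"
proof -
  define c where "c = (R / 2 * (b R / n)) powr e"
  have c: "0 < c" using R b_pos[of R] n_ge_1 by (simp add: c_def)
  define G where "G = \<kappa> * e * c * (R / 2)"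
  have G: "0 < G" using c R \<kappa>_pos e_pos by (simp add: G_def)
  show ?thesis
  proof (rule that[of "G powr (- 1 / (\<kappa> * e))"])
    fix a u assume sol: "solves a u" "0 < a" "0 \<le> u 1"
    have cont: "continuous_on {0..1} u" using sol by (simp add: solves_def)
    have pos: "0 < u r" if "r \<in> {0..<1}" for r
      using solves_pos[OF sol] that by simp
    have dec: "u s \<le> u r" if "0 \<le> r" "r \<le> s" "s \<le> 1" for r s
      using solves_decreasing[OF sol(1,2), of r s] that by (cases "r = s") auto
    have der: "((\<lambda>r. u r powr (- \<kappa> * e)) has_real_derivative
        - \<kappa> * e * u r powr (- \<kappa> * e - 1) * (- (flux u r powr e))) (at r)"
      if "0 < r" "r < 1" for r
      using DERIV_chain2[OF has_real_derivative_powr[of "u r" "- \<kappa> * e"] solves_deriv_at[OF sol(1) that]] pos[of r] that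
      by simp
    have low: "\<kappa> * e * c \<le> - \<kappa> * e * u r powr (- \<kappa> * e - 1) * (- (flux u r powr e))"
      if r: "R / 2 \<le> r" "r \<le> R" for r
    proof -
      have ur: "0 < u r" using pos[of r] r R by simp
      have "b R * u r powr q / n \<le> J u r"
      proof (rule J_ge[OF cont])
        show "b R * u r powr q \<le> F u t" if "t \<in> {0..r}" for t
          using that r R ur dec[of t r] b_decreasing[of t R] b_pos[of R] q_gt_1
          unfolding F_def by (intro mult_mono powr_mono2) auto
      qed (use r R in auto)
      then have "R / 2 * (b R * u r powr q / n) \<le> flux u r"
        unfolding flux_def using r R b_pos[of R] by (intro mult_mono) auto
      then have "(R / 2 * (b R / n) * u r powr q) powr e \<le> flux u r powr e"
        using R e_pos b_pos[of R] by (intro powr_mono2) (auto simp: mult_ac)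
      then have "c * u r powr (q * e) \<le> flux u r powr e"
        using R b_pos[of R] ur by (simp add: c_def powr_mult powr_powr powr_divide)
      moreover have "u r powr (- \<kappa> * e - 1) * u r powr (q * e) = 1"
      proof -
        have "- \<kappa> * e - 1 + q * e = 0" using \<kappa>_e by simp
        then show ?thesis using ur by (simp flip: powr_add)
      qed
      ultimately have "c \<le> u r powr (- \<kappa> * e - 1) * flux u r powr e"
        using mult_left_mono[of "c * u r powr (q * e)" "flux u r powr e" "u r powr (- \<kappa> * e - 1)"]
        by (simp add: mult_ac)
      then show ?thesis using \<kappa>_pos e_pos by (simp add: mult.assoc mult_left_mono)
    qed
    obtain z where z: "R / 2 < z" "z < R"
      "u R powr (- \<kappa> * e) - u (R / 2) powr (- \<kappa> * e)
        = (R - R / 2) * (- \<kappa> * e * u z powr (- \<kappa> * e - 1) * (- (flux u z powr e)))"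
      using MVT2[of "R / 2" R, OF _ der] R by auto
    have "G \<le> u R powr (- \<kappa> * e) - u (R / 2) powr (- \<kappa> * e)"
      using mult_left_mono[OF low[of z], of "R / 2"] z R by (simp add: G_def mult_ac)
    then have "G \<le> u R powr (- \<kappa> * e)"
      using powr_ge_zero[of "u (R / 2)" "- \<kappa> * e"] by linarith
    then have "(u R powr (- \<kappa> * e)) powr (- 1 / (\<kappa> * e)) \<le> G powr (- 1 / (\<kappa> * e))"
      using G \<kappa>_pos e_pos by (intro powr_mono2') (auto simp: divide_nonpos_pos)
    then show "u R \<le> G powr (- 1 / (\<kappa> * e))"
      using pos[of R] R \<kappa>_pos e_pos by (simp add: powr_powr)
  qed (use G in simp)
qed

text \<open>The slope at \<open>R\<close> is controlled by \<open>u(R)\<close>: the mass \<open>r^(n-1) y\<close> is nondecreasing, so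
the descent from \<open>R\<close> to 1, which is at most \<open>u(R)\<close>, is at least \<open>1 - R\<close> times
\<open>(R^(n-1) y(R)) powr e\<close>.\<close>

lemma pohozaev_upper:
  assumes R: "0 < R" "R < 1"
  obtains M where "\<And>a u. solves a u \<Longrightarrow> 0 < a \<Longrightarrow> 0 \<le> u 1 \<Longrightarrow> pohozaev u R \<le> M"
proof -
  obtain U where U: "0 < U" "\<And>a u. solves a u \<Longrightarrow> 0 < a \<Longrightarrow> 0 \<le> u 1 \<Longrightarrow> u R \<le> U"
    using a_priori_bound[OF R] by metis
  define Y where "Y = (U / (1 - R)) powr (p - 1) / R ^ (n - 1)"
  have Y: "0 \<le> Y" using R by (simp add: Y_def)
  show ?thesis
  proof (rule that[of "1 * ((p - 1) / p * Y powr (1 + e) + b R * U powr (q + 1) / (q + 1))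
      + \<bar>real n - p\<bar> / p * U * (1 * Y)"])
    fix a u assume sol: "solves a u" "0 < a" "0 \<le> u 1"
    have cont: "continuous_on {0..1} u" using sol by (simp add: solves_def)
    have uR: "0 < u R" "u R \<le> U" using solves_pos[OF sol, of R] R U(2)[OF sol] by auto
    have fR: "0 < flux u R" using flux_pos[OF sol(1,2), of R] R by simp
    define m where "m r = r ^ n * J u r" for r
    have m_mono: "m R \<le> m r" if "R \<le> r" "r \<le> 1" for r
    proof -
      have "integral {0..R} (\<lambda>t. t ^ (n - 1) * F u t) \<le> integral {0..r} (\<lambda>t. t ^ (n - 1) * F u t)"
      proof (rule integral_subset_le)
        have int: "(\<lambda>t. t ^ (n - 1) * F u t) integrable_on {0..1}"
          using cont by (intro integrable_continuous_real continuous_intros F_cont)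
        show "(\<lambda>t. t ^ (n - 1) * F u t) integrable_on {0..R}"
          "(\<lambda>t. t ^ (n - 1) * F u t) integrable_on {0..r}"
          using integrable_subinterval_real[OF int, of 0 R] integrable_subinterval_real[OF int, of 0 r] R that
          by auto
      qed (use R that F_nonneg in auto)
      then show ?thesis using J_scaled[OF cont] R that by (simp add: m_def)
    qed
    have flux_m: "m r = r ^ (n - 1) * flux u r" for r
      using power_n[of r] by (simp add: m_def flux_def mult_ac)
    obtain z where z: "R < z" "z < 1" "u 1 - u R = - (flux u z powr e) * (1 - R)"
    proof (rule mvt[of R 1 u "\<lambda>z. (*) (- (flux u z powr e))"])
      show "continuous_on {R..1} u" using cont R by (auto intro: continuous_on_subset)
      show "(u has_derivative (*) (- (flux u x powr e))) (at x)" if "R < x" "x < 1" for x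
        using solves_deriv_at[OF sol(1), of x] that R by (simp add: has_field_derivative_def)
    qed (use R in auto)
    have "m R \<le> flux u z"
    proof -
      have "m R \<le> z ^ (n - 1) * flux u z" using m_mono[of z] z flux_m by simp
      also have "\<dots> \<le> 1 * flux u z"
        using z R flux_pos[OF sol(1,2), of z] by (intro mult_right_mono power_le_one) auto
      finally show ?thesis by simp
    qed
    moreover have mR: "0 < m R" using fR R by (simp add: flux_m)
    ultimately have "m R powr e \<le> flux u z powr e" using e_pos by (intro powr_mono2) auto
    then have "(1 - R) * m R powr e \<le> (1 - R) * flux u z powr e" using R by simp
    also have "\<dots> \<le> U" using z uR sol(3) by (simp add: algebra_simps)
    finally have "m R powr e \<le> U / (1 - R)" using R by (simp add: field_simps)
    then have "(m R powr e) powr (p - 1) \<le> (U / (1 - R)) powr (p - 1)"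
      using p_gt_1 by (intro powr_mono2) auto
    then have "m R \<le> (U / (1 - R)) powr (p - 1)"
      using mR p_gt_1 by (simp add: powr_powr e_def)
    then have fY: "flux u R \<le> Y" using R by (simp add: Y_def flux_m field_simps)
    have "pohozaev u R \<le> R ^ n * ((p - 1) / p * flux u R powr (1 + e) + b R * u R powr (q + 1) / (q + 1))
       + \<bar>real n - p\<bar> / p * u R * (R ^ (n - 1) * flux u R)"
    proof -
      have "- (real n - p) * (u R * m R / p) \<le> \<bar>real n - p\<bar> * (u R * m R / p)"
        using uR mR p_gt_1 by (intro mult_right_mono) auto
      moreover have eq: "c / p * u R * m R = c * (u R * m R / p)" for c by simp
      ultimately show ?thesis
        unfolding pohozaev_def m_def[symmetric] flux_m[symmetric] eq by linarith
    qed
    also have "\<dots> \<le> 1 * ((p - 1) / p * Y powr (1 + e) + b R * U powr (q + 1) / (q + 1))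
      + \<bar>real n - p\<bar> / p * U * (1 * Y)"
      using R uR fR fY U Y p_gt_1 q_gt_1 e_pos b_pos[of R]
      by (intro add_mono mult_mono power_le_one powr_mono2 divide_right_mono mult_nonneg_nonneg
           add_nonneg_nonneg divide_nonneg_nonneg order_refl) auto
    finally show "pohozaev u R \<le> 1 * ((p - 1) / p * Y powr (1 + e) + b R * U powr (q + 1) / (q + 1))
      + \<bar>real n - p\<bar> / p * U * (1 * Y)" .
  qed
qed

text \<open>Up to the radius \<open>\<rho> a\<close>, proportional to \<open>a powr (- \<kappa> / p)\<close> (the natural length scale
of the equation), the solution stays above \<open>a / 2\<close>. Integrating the Pohozaev identity over
this ball gives at least a multiple of \<open>\<rho> a ^ n * a powr (q + 1) = const * a powr C0\<close>, and the
Pohozaev function keeps increasing up to the fixed radius \<open>R\<close>, below which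
\<open>r b' / b > - C0 / 2\<close>.\<close>

lemma pohozaev_lower:
  obtains R c A where "0 < R" "R < 1" "0 < c" "0 < A"
    "\<And>a u. A \<le> a \<Longrightarrow> solves a u \<Longrightarrow> 0 \<le> u 1 \<Longrightarrow> c * a powr C0 \<le> pohozaev u R"
proof -
  have "eventually (\<lambda>r. - (C0 / 2) < r * b' r / b r) (at_right 0)"
    using C0_pos by (intro order_tendstoD(1)[OF log_slope_tendsto_0]) auto
  then obtain R0 where R0: "0 < R0" "\<And>r. 0 < r \<Longrightarrow> r < R0 \<Longrightarrow> - (C0 / 2) < r * b' r / b r"
    unfolding eventually_at_right_field by auto
  define R where "R = min R0 1 / 2"
  have R: "0 < R" "R < 1" "R < R0" using R0 by (auto simp: R_def)
  \<comment> \<open>the constant for which \<open>S_bound a (\<rho> a) = a / 2\<close>\<close>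
  define k where "k = (1 / (2 * (b 0 / n) powr e)) powr (1 / (1 + e))"
  have k: "0 < k" using b_0_pos n_ge_1 by (simp add: k_def)
  define \<rho> where "\<rho> a = k * a powr (- (\<kappa> / p))" for a
  have "((\<lambda>a. k * a powr (- (\<kappa> / p))) \<longlongrightarrow> k * 0) at_top"
    using \<kappa>_pos p_gt_1 by (intro tendsto_intros tendsto_neg_powr filterlim_ident) auto
  then have "eventually (\<lambda>a. \<rho> a < R) at_top"
    using R by (intro order_tendstoD(2)) (auto simp: \<rho>_def)
  then obtain A where A: "\<And>a. A \<le> a \<Longrightarrow> \<rho> a < R" by (auto simp: eventually_at_top_linorder)
  define c0 where "c0 = C0 / 2 * b R / ((q + 1) * n)"
  have c0: "0 < c0" using C0_pos b_pos[of R] R q_gt_1 n_ge_1 by (simp add: c0_def)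
  show ?thesis
  proof (rule that[of R "c0 * k ^ n / 2 powr (q + 1)" "max A 1"])
    fix a u assume a: "max A 1 \<le> a" and sol: "solves a u" "0 \<le> u 1"
    have a0: "0 < a" using a by simp
    have cont: "continuous_on {0..1} u" using sol by (simp add: solves_def)
    have pos: "0 < u r" if "r \<in> {0..<1}" for r
      using solves_pos[OF sol(1) a0 sol(2)] that by simp
    have dec: "u s \<le> u r" if "0 \<le> r" "r \<le> s" "s \<le> 1" for r s
      using solves_decreasing[OF sol(1) a0, of r s] that by (cases "r = s") auto
    have \<rho>: "0 < \<rho> a" "\<rho> a < R" using A[of a] a a0 k by (auto simp: \<rho>_def)
    have "S_bound a (\<rho> a) = a / 2"
    proof -
      have "S_bound a (\<rho> a) = \<rho> a powr (1 + e) * a powr (q * e) * (b 0 / n) powr e"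
        using \<rho> a0 b_0_pos n_ge_1
        by (simp add: S_bound_def powr_mult powr_powr powr_divide powr_add)
      also have "\<rho> a powr (1 + e) = 1 / (2 * (b 0 / n) powr e) * a powr (- (\<kappa> * e))"
      proof -
        have "- (\<kappa> / p) * (1 + e) = - (\<kappa> * e)" using p_gt_1 by (simp add: e_def field_simps)
        moreover have "k powr (1 + e) = 1 / (2 * (b 0 / n) powr e)"
          using e_pos b_0_pos n_ge_1 unfolding k_def by (simp add: powr_powr)
        ultimately show ?thesis using k a0 unfolding \<rho>_def by (simp add: powr_mult powr_powr)
      qed
      also have "1 / (2 * (b 0 / n) powr e) * a powr (- (\<kappa> * e)) * a powr (q * e) * (b 0 / n) powr e
          = a powr (- (\<kappa> * e)) * a powr (q * e) / 2"
        using b_0_pos n_ge_1 by simp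
      also have "a powr (- (\<kappa> * e)) * a powr (q * e) = a powr (- (\<kappa> * e) + q * e)"
        by (rule powr_add[symmetric])
      also have "- (\<kappa> * e) + q * e = 1" using \<kappa>_e by simp
      finally show ?thesis using a0 by simp
    qed
    moreover have "S u (\<rho> a) \<le> S_bound a (\<rho> a)"
      using sol a0 \<rho> R by (intro S_upper cont solves_upper[OF sol(1)]) auto
    ultimately have u_\<rho>: "a / 2 \<le> u (\<rho> a)" using sol \<rho> R by (auto simp: solves_def)
    have Pc: "continuous_on {0..1} (pohozaev u)" by (rule pohozaev_cont[OF sol(1) a0 sol(2)])
    define h where "h = C0 / 2 * b R * (a / 2) powr (q + 1) / ((q + 1) * n)"
    have "pohozaev u 0 - h * 0 ^ n \<le> pohozaev u (\<rho> a) - h * \<rho> a ^ n"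
    proof (rule DERIV_nonneg_imp_increasing_open[where f = "\<lambda>r. pohozaev u r - h * r ^ n"])
      show "continuous_on {0..\<rho> a} (\<lambda>r. pohozaev u r - h * r ^ n)"
        using \<rho> R by (intro continuous_intros continuous_on_subset[OF Pc]) auto
      fix r assume r: "0 < r" "r < \<rho> a"
      then have r1: "r < 1" "r < R0" "r < R" using \<rho> R by auto
      have "((\<lambda>r. pohozaev u r - h * r ^ n) has_real_derivative
        r ^ (n - 1) * (b r * u r powr (q + 1) / (q + 1)) * (C0 + r * b' r / b r)
        - h * (n * r ^ (n - 1))) (at r)"
        using r1 r pos[of r] by (auto intro!: derivative_eq_intros pohozaev_deriv sol(1) a0)
      moreover have "h * (n * r ^ (n - 1))
          = r ^ (n - 1) * (b R * (a / 2) powr (q + 1) / (q + 1)) * (C0 / 2)"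
      proof -
        define Q where "Q = q + 1"
        have "Q \<noteq> 0" using q_gt_1 by (simp add: Q_def)
        then show ?thesis unfolding h_def Q_def[symmetric] using n_ge_1 by (simp add: field_simps)
      qed
      moreover have "r ^ (n - 1) * (b R * (a / 2) powr (q + 1) / (q + 1)) * (C0 / 2)
          \<le> r ^ (n - 1) * (b r * u r powr (q + 1) / (q + 1)) * (C0 + r * b' r / b r)"
      proof -
        define s where "s = r * b' r / b r"
        have "- (C0 / 2) < s" using R0(2)[of r] r r1 by (simp add: s_def)
        then show ?thesis
          unfolding s_def[symmetric]
          using r r1 R \<rho> b_pos[of r] b_pos[of R] b_decreasing[of r R] u_\<rho> dec[of r "\<rho> a"]
            C0_pos q_gt_1 a0
          by (intro mult_mono divide_right_mono powr_mono2 mult_nonneg_nonneg divide_nonneg_nonneg) auto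
      qed
      ultimately show "\<exists>y. ((\<lambda>r. pohozaev u r - h * r ^ n) has_real_derivative y) (at r) \<and> 0 \<le> y"
        by (intro exI conjI) auto
    qed (use \<rho> in auto)
    then have "h * \<rho> a ^ n \<le> pohozaev u (\<rho> a)"
      using n_ge_1 by (simp add: pohozaev_0 power_0_left)
    also have "\<dots> \<le> pohozaev u R"
    proof (rule DERIV_nonneg_imp_increasing_open[where f = "pohozaev u"])
      show "continuous_on {\<rho> a..R} (pohozaev u)"
        using \<rho> R by (intro continuous_on_subset[OF Pc]) auto
      fix r assume r: "\<rho> a < r" "r < R"
      then have r1: "0 < r" "r < 1" "r < R0" using \<rho> R by auto
      have "0 \<le> r ^ (n - 1) * (b r * u r powr (q + 1) / (q + 1)) * (C0 + r * b' r / b r)"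
        using r1 R0(2)[of r] b_pos[of r] q_gt_1 C0_pos
        by (intro mult_nonneg_nonneg divide_nonneg_nonneg) auto
      moreover have "(pohozaev u has_real_derivative
          r ^ (n - 1) * (b r * u r powr (q + 1) / (q + 1)) * (C0 + r * b' r / b r)) (at r)"
        using r1 pos[of r] by (intro pohozaev_deriv[OF sol(1) a0]) auto
      ultimately show "\<exists>y. (pohozaev u has_real_derivative y) (at r) \<and> 0 \<le> y" by blast
    qed (use \<rho> in auto)
    also have "h * \<rho> a ^ n = c0 * k ^ n / 2 powr (q + 1) * a powr C0"
    proof -
      have eq: "a powr (q + 1) * (a powr (- (\<kappa> / p))) ^ n = a powr C0"
      proof -
        have "q + 1 + real n * (- (\<kappa> / p)) = C0"
          using p_gt_1 by (simp add: \<kappa>_def C0_def field_simps)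
        then show ?thesis using a0 by (simp add: powr_power flip: powr_add)
      qed
      then show ?thesis
        unfolding h_def c0_def \<rho>_def
        using a0 by (simp add: power_mult_distrib powr_divide mult_ac flip: eq)
    qed
    finally show "c0 * k ^ n / 2 powr (q + 1) * a powr C0 \<le> pohozaev u R" .
  qed (use R c0 k in auto)
qed

lemma solves_large:
  obtains A where "0 < A" "\<And>a u. A \<le> a \<Longrightarrow> solves a u \<Longrightarrow> u 1 < 0"
proof -
  obtain R c A where R: "0 < R" "R < 1" "0 < c" "0 < A"
    and low: "\<And>a u. A \<le> a \<Longrightarrow> solves a u \<Longrightarrow> 0 \<le> u 1 \<Longrightarrow> c * a powr C0 \<le> pohozaev u R"
    using pohozaev_lower by metis
  obtain M where up: "\<And>a u. solves a u \<Longrightarrow> 0 < a \<Longrightarrow> 0 \<le> u 1 \<Longrightarrow> pohozaev u R \<le> M"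
    using pohozaev_upper[OF R(1,2)] by metis
  define B where "B = ((\<bar>M\<bar> + 1) / c) powr (1 / C0)"
  show ?thesis
  proof (rule that[of "max A B"])
    fix a u assume a: "max A B \<le> a" and sol: "solves a u"
    show "u 1 < 0"
    proof (rule ccontr)
      assume "\<not> u 1 < 0"
      then have "c * a powr C0 \<le> M"
        using low[of a u] up[of a u] a sol R by force
      moreover have "(\<bar>M\<bar> + 1) / c \<le> a powr C0"
      proof -
        have "B powr C0 \<le> a powr C0" using a C0_pos by (intro powr_mono2) (auto simp: B_def)
        then show ?thesis using R C0_pos by (simp add: B_def powr_powr)
      qed
      ultimately show False using R by (simp add: field_simps)
    qed
  qed (use R in auto)
qed

lemma shooting:
  "\<exists>a>0. \<exists>u. solves a u \<and> u 1 = 0"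
proof -
  obtain a0 where a0: "0 < a0" "\<And>u. solves a0 u \<Longrightarrow> 0 < u 1" using solves_small by metis
  obtain A where A: "0 < A" "\<And>a u. A \<le> a \<Longrightarrow> solves a u \<Longrightarrow> u 1 < 0" using solves_large by metis
  define a1 where "a1 = max a0 A"
  define sol where "sol a = (SOME u. solves a u)" for a
  have sol: "solves a (sol a)" if "0 < a" for a
    unfolding sol_def by (rule someI_ex[OF solves_exists[OF that]])
  obtain L where L: "0 \<le> L"
    "\<And>a c u v r. a \<in> {a0..a1} \<Longrightarrow> c \<in> {a0..a1} \<Longrightarrow> solves a u \<Longrightarrow> solves c v \<Longrightarrow> r \<in> {0..1} \<Longrightarrow>
       \<bar>u r - v r\<bar> \<le> L * \<bar>a - c\<bar>"
    using solves_continuous_dependence[of a0 a1] a0 by (auto simp: a1_def)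
  have "continuous_on {a0..a1} (\<lambda>a. sol a 1)"
  proof (rule lipschitz_on_continuous_on[where L = L])
    show "L-lipschitz_on {a0..a1} (\<lambda>a. sol a 1)"
      using L a0 sol by (intro lipschitz_onI) (auto simp: dist_real_def)
  qed
  then have "\<exists>a. a0 \<le> a \<and> a \<le> a1 \<and> sol a 1 = 0"
    using a0 less_imp_le[OF A(2)[of a1 "sol a1"]] A(1) sol by (intro IVT2') (auto simp: a1_def intro: less_imp_le)
  then show ?thesis using sol a0 by (meson less_le_trans)
qed

lemma positive_solution_exists: "\<exists>u. positive_solution n p q b u"
  using shooting solves_positive_solution by blast

section \<open>Comparison of curves in the Emden-Fowler phase plane\<close>

definition \<beta> :: "real \<Rightarrow> real" where "\<beta> r = r * b' r / b r"

definition H :: "real \<Rightarrow> real" where "H v = (p - real n) * v + (p - 1) * v powr (1 + e)"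

text \<open>An orbit of the Emden-Fowler system as a graph over \<open>v = V\<close>: time \<open>t = ln r\<close> and
\<open>L = ln Z\<close> as functions of \<open>v\<close>, with the derivatives \<open>dt/dv\<close> and \<open>dL/dv\<close> that the system
prescribes. The limits at 0 say that the orbit comes from a regular centre; \<open>c\<close> is the leading
coefficient of \<open>V\<close> there, \<open>V ~ c r^p\<close>, and it encodes the value of the solution at the
centre. The limit at infinity places the zero of the solution at \<open>r = 1\<close>.\<close>

definition phase_curve :: "real \<Rightarrow> (real \<Rightarrow> real) \<Rightarrow> (real \<Rightarrow> real) \<Rightarrow> bool" where
  "phase_curve c t L \<longleftrightarrow>
     (\<forall>v>0. t v < 0 \<and> 0 < H v + exp (L v)
        \<and> (t has_real_derivative 1 / (H v + exp (L v))) (at v)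
        \<and> (L has_real_derivative (p + \<beta> (exp (t v)) - \<kappa> * v powr e) / (H v + exp (L v))) (at v))
     \<and> ((\<lambda>v. exp (t v)) \<longlongrightarrow> 0) (at_right 0)
     \<and> ((\<lambda>v. v / exp (t v) powr p) \<longlongrightarrow> c) (at_right 0)
     \<and> ((\<lambda>v. exp (L v) / v) \<longlongrightarrow> real n) (at_right 0)
     \<and> (t \<longlongrightarrow> 0) at_top"

lemma \<beta>_antimono: "0 < r \<Longrightarrow> r \<le> s \<Longrightarrow> s < 1 \<Longrightarrow> \<beta> s \<le> \<beta> r"
  unfolding \<beta>_def by (rule log_slope_antimono)

lemma \<beta>_cont: "continuous_on {0<..<1} \<beta>"
proof -
  have sub: "{0<..<1} \<subseteq> {0..1::real}" by auto
  have "b r \<noteq> 0" if "r \<in> {0<..<1}" for r using b_pos[of r] that by simp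
  then show ?thesis unfolding \<beta>_def[abs_def]
    by (intro continuous_intros continuous_on_subset[OF b_cont sub] continuous_on_subset[OF b'_cont sub]) auto
qed

text \<open>A larger \<open>c\<close> means an earlier start. The delay \<open>\<tau>\<close> of the second curve and the excess
\<open>\<delta>\<close> of the first in \<open>ln Z\<close> support each other: while \<open>\<tau> > 0\<close>, the monotonicity of \<open>\<beta>\<close>
prevents \<open>\<delta>\<close> from becoming negative, and \<open>\<delta> \<ge> 0\<close> prevents \<open>\<tau>\<close> from decreasing. So \<open>\<tau>\<close>
stays bounded away from 0, although both times tend to 0.\<close>

lemma phase_curve_order:
  assumes 1: "phase_curve c1 t1 L1" and 2: "phase_curve c2 t2 L2" and c: "0 < c2" "c2 < c1"
  shows False
proof -
  have t_neg: "t1 v < 0" "t2 v < 0"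
    and D_pos: "0 < H v + exp (L1 v)" "0 < H v + exp (L2 v)"
    and dt: "(t1 has_real_derivative 1 / (H v + exp (L1 v))) (at v)"
            "(t2 has_real_derivative 1 / (H v + exp (L2 v))) (at v)"
    and dL: "(L1 has_real_derivative (p + \<beta> (exp (t1 v)) - \<kappa> * v powr e) / (H v + exp (L1 v))) (at v)"
            "(L2 has_real_derivative (p + \<beta> (exp (t2 v)) - \<kappa> * v powr e) / (H v + exp (L2 v))) (at v)"
    if "0 < v" for v
    using 1 2 that by (auto simp: phase_curve_def)
  define \<tau> where "\<tau> v = t2 v - t1 v" for v
  define \<delta> where "\<delta> v = L1 v - L2 v" for v
  define K where "K v = p + \<beta> (exp (t2 v)) - \<kappa> * v powr e" for v
  define D1 where "D1 v = H v + exp (L1 v)" for v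
  define D2 where "D2 v = H v + exp (L2 v)" for v
  define \<delta>' where "\<delta>' v = (p + \<beta> (exp (t1 v)) - \<kappa> * v powr e) / D1 v - K v / D2 v" for v
  have D: "0 < D1 v" "0 < D2 v" if "0 < v" for v using D_pos[OF that] by (auto simp: D1_def D2_def)
  have d\<delta>: "(\<delta> has_real_derivative \<delta>' v) (at v)" if "0 < v" for v
    unfolding \<delta>_def[abs_def] \<delta>'_def D1_def D2_def K_def by (intro DERIV_diff dL that)
  have d\<tau>: "(\<tau> has_real_derivative 1 / D2 v - 1 / D1 v) (at v)" if "0 < v" for v
    unfolding \<tau>_def[abs_def] D1_def D2_def by (intro DERIV_diff dt that)
  have \<tau>'_nonneg: "0 \<le> 1 / D2 v - 1 / D1 v" if "0 < v" "0 \<le> \<delta> v" for v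
  proof -
    have "D2 v \<le> D1 v" using that by (simp add: D1_def D2_def \<delta>_def)
    then show ?thesis using D[OF that(1)] by (simp add: frac_le)
  qed
  \<comment> \<open>as \<open>\<beta>\<close> is nonincreasing, the smaller radius \<open>exp (t1 v)\<close> has the larger \<open>\<beta>\<close>\<close>
  have \<delta>'_ge: "K v * (1 / D1 v - 1 / D2 v) \<le> \<delta>' v" if v: "0 < v" "0 < \<tau> v" for v
  proof -
    have "\<beta> (exp (t2 v)) \<le> \<beta> (exp (t1 v))"
      using v t_neg[OF v(1)] by (intro \<beta>_antimono) (auto simp: \<tau>_def)
    then have "K v / D1 v \<le> (p + \<beta> (exp (t1 v)) - \<kappa> * v powr e) / D1 v"
      using D[OF v(1)] by (intro divide_right_mono) (auto simp: K_def)
    then show ?thesis by (simp add: \<delta>'_def algebra_simps)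
  qed
  have inv_diff: "0 < 1 / D1 v - 1 / D2 v" "1 / D1 v - 1 / D2 v \<le> exp (L2 v) / (D1 v * D2 v) * - \<delta> v"
    if v: "0 < v" "\<delta> v < 0" for v
  proof -
    have "D1 v < D2 v" using v by (simp add: D1_def D2_def \<delta>_def)
    then show "0 < 1 / D1 v - 1 / D2 v" using D[OF v(1)] by (simp add: frac_less2)
    have "1 / D1 v - 1 / D2 v = (exp (L2 v) - exp (L1 v)) / (D1 v * D2 v)"
      using D[OF v(1)] by (simp add: diff_frac_eq) (simp add: D1_def D2_def)
    also have "exp (L2 v) - exp (L1 v) \<le> exp (L2 v) * - \<delta> v"
    proof -
      have "exp (L1 v) = exp (L2 v) * exp (\<delta> v)" by (simp add: \<delta>_def flip: exp_add)
      then show ?thesis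
        using mult_left_mono[OF exp_ge_add_one_self[of "\<delta> v"], of "exp (L2 v)"] by (simp add: algebra_simps)
    qed
    finally show "1 / D1 v - 1 / D2 v \<le> exp (L2 v) / (D1 v * D2 v) * - \<delta> v"
      using D[OF v(1)] by (simp add: divide_right_mono)
  qed
  have lim_c: "((\<lambda>v. v / exp (t1 v) powr p) \<longlongrightarrow> c1) (at_right 0)"
      "((\<lambda>v. v / exp (t2 v) powr p) \<longlongrightarrow> c2) (at_right 0)"
    and lim_n: "((\<lambda>v. exp (L1 v) / v) \<longlongrightarrow> real n) (at_right 0)"
      "((\<lambda>v. exp (L2 v) / v) \<longlongrightarrow> real n) (at_right 0)"
    and lim_r: "((\<lambda>v. exp (t2 v)) \<longlongrightarrow> 0) (at_right 0)"
    and lim_t: "(t1 \<longlongrightarrow> 0) at_top"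
    using 1 2 by (auto simp: phase_curve_def)
  have pos_ev: "eventually (\<lambda>v::real. 0 < v) (at_right 0)" by (rule eventually_at_right_less)
  have ev1: "eventually (\<lambda>v. 0 < \<tau> v) (at_right 0)"
  proof -
    have "eventually (\<lambda>v. v / exp (t2 v) powr p < (c1 + c2) / 2) (at_right 0)"
      "eventually (\<lambda>v. (c1 + c2) / 2 < v / exp (t1 v) powr p) (at_right 0)"
      using order_tendstoD(2)[OF lim_c(2), of "(c1 + c2) / 2"]
        order_tendstoD(1)[OF lim_c(1), of "(c1 + c2) / 2"] c by auto
    then show ?thesis using pos_ev
    proof eventually_elim
      case (elim v)
      then have "v / exp (t2 v) powr p < v / exp (t1 v) powr p" by linarith
      then have "exp (p * t1 v) < exp (p * t2 v)"
        using elim by (simp add: exp_powr_real mult.commute divide_less_cancel frac_less2 field_simps)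
      then show ?case using p_gt_1 by (simp add: \<tau>_def)
    qed
  qed
  have \<delta>_lim: "(\<delta> \<longlongrightarrow> 0) (at_right 0)"
  proof -
    have "((\<lambda>v. ln ((exp (L1 v) / v) / (exp (L2 v) / v))) \<longlongrightarrow> ln (real n / real n)) (at_right 0)"
      using n_ge_1 by (intro tendsto_intros lim_n) auto
    moreover have "eventually (\<lambda>v. ln ((exp (L1 v) / v) / (exp (L2 v) / v)) = \<delta> v) (at_right 0)"
      using pos_ev by eventually_elim (simp add: \<delta>_def flip: exp_diff)
    ultimately show ?thesis using n_ge_1 by (simp add: tendsto_cong)
  qed
  have ev2: "eventually (\<lambda>v. 0 < K v) (at_right 0)"
  proof -
    have "filterlim (\<lambda>v. exp (t2 v)) (at_right 0) (at_right 0)"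
      using lim_r by (auto simp: filterlim_at)
    then have "((\<lambda>v. \<beta> (exp (t2 v))) \<longlongrightarrow> 0) (at_right 0)"
      using log_slope_tendsto_0 unfolding \<beta>_def by (rule filterlim_compose[rotated])
    moreover have "((\<lambda>v::real. v powr e) \<longlongrightarrow> 0) (at_right 0)"
      using e_pos by (intro tendsto_eq_intros) (auto intro: eventually_at_right_less[THEN eventually_mono])
    ultimately have "(K \<longlongrightarrow> p + 0 - \<kappa> * 0) (at_right 0)"
      unfolding K_def[abs_def] by (intro tendsto_intros)
    then show ?thesis using p_gt_1 by (intro order_tendstoD(1)) auto
  qed
  obtain v1 where v1: "0 < v1" "\<And>v. 0 < v \<Longrightarrow> v < v1 \<Longrightarrow> 0 < \<tau> v \<and> 0 < K v"
    using eventually_conj[OF ev1 ev2] unfolding eventually_at_right_field by auto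
  define v0 where "v0 = v1 / 2"
  have v0: "0 < v0" "\<And>v. 0 < v \<Longrightarrow> v \<le> v0 \<Longrightarrow> 0 < \<tau> v \<and> 0 < K v"
    using v1 by (auto simp: v0_def)
  \<comment> \<open>Near \<open>v = 0\<close> the factor \<open>K\<close> is positive, so a negative \<open>\<delta>\<close> would stay below a
    negative constant as \<open>v \<rightarrow> 0\<close>.\<close>
  have \<delta>_v0: "0 \<le> \<delta> v0"
  proof (rule ccontr)
    assume neg: "\<not> 0 \<le> \<delta> v0"
    have "\<delta> v \<le> \<delta> v0" if v: "0 < v" "v < v0" for v
    proof (rule negative_backwards[where g = \<delta> and g' = \<delta>'])
      show "0 \<le> \<delta>' x" if x: "v \<le> x" "x \<le> v0" "\<delta> x < 0" for x
      proof -
        have "0 \<le> K x * (1 / D1 x - 1 / D2 x)"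
          using v0(2)[of x] inv_diff(1)[of x] x v by (intro mult_nonneg_nonneg) auto
        then show ?thesis using \<delta>'_ge[of x] v0(2)[of x] x v by auto
      qed
    qed (use v neg d\<delta> in auto)
    then have "eventually (\<lambda>v. \<delta> v \<le> \<delta> v0) (at_right 0)"
      using v0(1) by (auto simp: eventually_at_right_field)
    then have "0 \<le> \<delta> v0" by (intro tendsto_upperbound[OF \<delta>_lim]) auto
    then show False using neg by simp
  qed
  \<comment> \<open>Beyond \<open>v0\<close> the sign of \<open>K\<close> may change; on compact intervals \<open>\<delta>' \<ge> C * \<delta>\<close> where
    \<open>\<delta> < 0\<close>, which suffices by an integrating factor.\<close>
  have \<delta>_stays: "0 \<le> \<delta> w" if w: "v0 \<le> w" and \<tau>: "\<And>v. v0 \<le> v \<Longrightarrow> v \<le> w \<Longrightarrow> 0 < \<tau> v" for w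
  proof (rule ccontr)
    assume neg: "\<not> 0 \<le> \<delta> w"
    have cont: "continuous_on {v0..w} (\<lambda>v. \<bar>K v\<bar> * (exp (L2 v) / (D1 v * D2 v)))"
    proof -
      have pos: "0 < v" if "v \<in> {v0..w}" for v using that v0 by simp
      have ct: "continuous_on {v0..w} t2" "continuous_on {v0..w} L1" "continuous_on {v0..w} L2"
        using pos dt dL by (blast intro: continuous_at_imp_continuous_on DERIV_isCont)+
      have cb: "continuous_on {v0..w} (\<lambda>v. \<beta> (exp (t2 v)))"
        by (rule continuous_on_compose2[OF \<beta>_cont]) (use pos t_neg in \<open>auto intro!: continuous_intros ct\<close>)
      have cH: "continuous_on {v0..w} H"
        unfolding H_def[abs_def] using v0 by (intro continuous_intros) auto
      have nz: "H v + exp (L1 v) \<noteq> 0" "H v + exp (L2 v) \<noteq> 0" if "v \<in> {v0..w}" for v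
        using D_pos[OF pos[OF that]] by auto
      have cp: "continuous_on {v0..w} (\<lambda>v. v powr e)"
        using v0 by (intro continuous_intros) auto
      show ?thesis
        unfolding K_def D1_def D2_def using nz
        by (intro continuous_on_mult continuous_on_rabs continuous_on_divide continuous_on_diff
           continuous_on_add continuous_on_const continuous_on_exp ct cb cH cp) auto
    qed
    obtain z where z: "\<And>v. v \<in> {v0..w} \<Longrightarrow>
        \<bar>K v\<bar> * (exp (L2 v) / (D1 v * D2 v)) \<le> \<bar>K z\<bar> * (exp (L2 z) / (D1 z * D2 z))"
      using continuous_attains_sup[OF compact_Icc _ cont] w by (metis atLeastAtMost_iff empty_iff order_refl)
    define C where "C = \<bar>K z\<bar> * (exp (L2 z) / (D1 z * D2 z))"
    have growth: "C * \<delta> v \<le> \<delta>' v" if v: "v0 \<le> v" "v \<le> w" "\<delta> v < 0" for v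
    proof -
      have pos: "0 < v" using v v0 by simp
      have "C * \<delta> v \<le> \<bar>K v\<bar> * (exp (L2 v) / (D1 v * D2 v)) * \<delta> v"
        using z[of v] v by (intro mult_right_mono_neg) (auto simp: C_def)
      also have "\<dots> \<le> - (\<bar>K v\<bar> * (1 / D1 v - 1 / D2 v))"
        using mult_left_mono[OF inv_diff(2)[OF pos v(3)], of "\<bar>K v\<bar>"] by (simp add: mult_ac)
      also have "\<dots> \<le> K v * (1 / D1 v - 1 / D2 v)"
        using inv_diff(1)[OF pos v(3)] mult_right_mono[of "- \<bar>K v\<bar>" "K v" "1 / D1 v - 1 / D2 v"] by simp
      also have "\<dots> \<le> \<delta>' v" using \<delta>'_ge[OF pos \<tau>] v by simp
      finally show ?thesis .
    qed
    have \<delta>_w: "\<delta> w * exp (- C * w) < 0" using neg by (simp add: mult_less_0_iff)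
    have "\<delta> v0 * exp (- C * v0) \<le> \<delta> w * exp (- C * w)"
    proof (rule negative_backwards[where g = "\<lambda>v. \<delta> v * exp (- C * v)"
          and g' = "\<lambda>v. \<delta>' v * exp (- C * v) + - C * exp (- C * v) * \<delta> v"])
      fix v assume v: "v0 \<le> v" "v \<le> w"
      then have "0 < v" using v0(1) by simp
      moreover have "((\<lambda>v. exp (- C * v)) has_real_derivative - C * exp (- C * v)) (at v)"
        by (auto intro!: derivative_eq_intros)
      ultimately show "((\<lambda>v. \<delta> v * exp (- C * v)) has_real_derivative
          \<delta>' v * exp (- C * v) + - C * exp (- C * v) * \<delta> v) (at v)"
        by (intro DERIV_mult d\<delta>)
      assume "\<delta> v * exp (- C * v) < 0"
      then have "\<delta> v < 0" by (simp add: mult_less_0_iff)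
      then have "0 \<le> (\<delta>' v - C * \<delta> v) * exp (- C * v)"
        using growth[OF v] by (intro mult_nonneg_nonneg) auto
      also have "\<dots> = \<delta>' v * exp (- C * v) + - C * exp (- C * v) * \<delta> v"
        by (simp add: algebra_simps)
      finally show "0 \<le> \<delta>' v * exp (- C * v) + - C * exp (- C * v) * \<delta> v" .
    qed (use w \<delta>_w in auto)
    with \<delta>_w have "\<delta> v0 * exp (- C * v0) < 0" by linarith
    then show False using \<delta>_v0 by (simp add: mult_less_0_iff)
  qed
  have \<tau>_cont: "continuous_on {v0..w} \<tau>" for w
    using v0(1) by (intro continuous_at_imp_continuous_on ballI DERIV_isCont[OF d\<tau>]) auto
  have \<tau>_mono: "\<tau> v0 \<le> \<tau> w" if w: "v0 \<le> w" "\<And>v. v0 \<le> v \<Longrightarrow> v < w \<Longrightarrow> 0 < \<tau> v" for w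
  proof (rule DERIV_nonneg_imp_increasing_open[OF w(1) _ \<tau>_cont])
    fix x assume x: "v0 < x" "x < w"
    then have "0 \<le> \<delta> x" using w(2) by (intro \<delta>_stays) auto
    then show "\<exists>y. (\<tau> has_real_derivative y) (at x) \<and> 0 \<le> y"
      using d\<tau>[of x] \<tau>'_nonneg[of x] x v0 by auto
  qed
  have \<tau>0: "0 < \<tau> v0" using v0 by auto
  have \<tau>_ge: "\<tau> v0 \<le> \<tau> w" if w: "v0 \<le> w" for w
  proof (cases "\<forall>v. v0 \<le> v \<longrightarrow> v < w \<longrightarrow> 0 < \<tau> v")
    case True
    then show ?thesis using \<tau>_mono[OF w] by auto
  next
    case False
    \<comment> \<open>at the first point \<open>s\<close> where \<open>\<tau> \<le> 0\<close>, the monotonicity on \<open>[v0,s]\<close> is violated\<close>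
    define B where "B = {v \<in> {v0..w}. \<tau> v \<le> 0}"
    have "B = {v0..w} \<inter> \<tau> -` {..0}" by (auto simp: B_def)
    then have "closed B" using continuous_closed_preimage[OF \<tau>_cont] by simp
    moreover have "bounded B" by (rule bounded_subset[of "{v0..w}"]) (auto simp: B_def)
    ultimately have "compact B" by (simp add: compact_eq_bounded_closed)
    moreover have "B \<noteq> {}"
    proof -
      from False obtain v where "v0 \<le> v" "v < w" "\<tau> v \<le> 0" by (auto simp: not_less)
      then have "v \<in> B" by (simp add: B_def)
      then show ?thesis by blast
    qed
    ultimately obtain s where s: "s \<in> B" "\<And>v. v \<in> B \<Longrightarrow> s \<le> v"
      using compact_attains_inf[of B] by blast
    have "\<tau> v0 \<le> \<tau> s"
    proof (rule \<tau>_mono)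
      show "0 < \<tau> v" if "v0 \<le> v" "v < s" for v
        using s(2)[of v] s(1) that by (force simp: B_def)
    qed (use s in \<open>auto simp: B_def\<close>)
    then show ?thesis using s(1) \<tau>0 by (auto simp: B_def)
  qed
  have "eventually (\<lambda>v. - \<tau> v0 < t1 v) at_top"
    using lim_t \<tau>0 by (intro order_tendstoD(1)) auto
  then obtain N where N: "\<And>v. N \<le> v \<Longrightarrow> - \<tau> v0 < t1 v"
    unfolding eventually_at_top_linorder by blast
  define v where "v = max N v0"
  have v: "v0 \<le> v" "- \<tau> v0 < t1 v" using N[of v] by (auto simp: v_def)
  have "0 < t2 v" using v \<tau>_ge[of v] by (simp add: \<tau>_def)
  then show False using t_neg(2)[of v] v(1) v0(1) by simp
qed

section \<open>Solutions as phase curves, and uniqueness\<close>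

text \<open>Since \<open>flux u\<close> is \<open>- \<phi>(u')\<close>, this is \<open>(- r u' / u)^(p-1)\<close>.\<close>

definition V :: "(real \<Rightarrow> real) \<Rightarrow> real \<Rightarrow> real" where
  "V u r = (r / u r) powr (p - 1) * flux u r"

definition logZ :: "(real \<Rightarrow> real) \<Rightarrow> real \<Rightarrow> real" where
  "logZ u r = p * ln r + ln (b r) + \<kappa> * ln (u r)"

context
  fixes a u
  assumes sol: "solves a u" and a_pos: "0 < a" and u_1: "u 1 = 0"
begin

lemma u_cont: "continuous_on {0..1} u" using sol by (simp add: solves_def)

lemma u_pos: "0 \<le> r \<Longrightarrow> r < 1 \<Longrightarrow> 0 < u r"
  using solves_pos[OF sol a_pos] u_1 by simp

text \<open>As \<open>\<beta>\<close> is nonincreasing, \<open>C0 + \<beta>\<close> changes sign at most once, from positive to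
negative. So the Pohozaev function first increases from its value 0 at the centre and then
decreases to a nonnegative value at the zero of \<open>u\<close>.\<close>

lemma pohozaev_nonneg:
  assumes r: "0 < r" "r < 1" shows "0 \<le> pohozaev u r"
proof -
  have Pc: "continuous_on {0..1} (pohozaev u)" using sol a_pos u_1 by (intro pohozaev_cont) auto
  define P' where "P' s = s ^ (n - 1) * (b s * u s powr (q + 1) / (q + 1)) * (C0 + \<beta> s)" for s
  have dP: "(pohozaev u has_real_derivative P' s) (at s)" if "0 < s" "s < 1" for s
    unfolding P'_def \<beta>_def using that by (intro pohozaev_deriv[OF sol a_pos] u_pos) auto
  have w: "0 \<le> s ^ (n - 1) * (b s * u s powr (q + 1) / (q + 1))" if "0 < s" "s < 1" for s
    using that b_pos[of s] q_gt_1 by simp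
  show ?thesis
  proof (cases "0 \<le> C0 + \<beta> r")
    case True
    have "pohozaev u 0 \<le> pohozaev u r"
    proof (rule DERIV_nonneg_imp_increasing_open[where f = "pohozaev u"])
      fix s assume s: "0 < s" "s < r"
      then have "0 \<le> C0 + \<beta> s" using \<beta>_antimono[of s r] r True by simp
      then have "0 \<le> P' s"
        unfolding P'_def using s r by (intro mult_nonneg_nonneg[OF w]) auto
      then show "\<exists>y. (pohozaev u has_real_derivative y) (at s) \<and> 0 \<le> y"
        using dP[of s] s r by auto
    qed (use r in \<open>auto intro: continuous_on_subset[OF Pc]\<close>)
    then show ?thesis by (simp add: pohozaev_0)
  next
    case False
    have "pohozaev u 1 \<le> pohozaev u r"
    proof (rule DERIV_nonpos_imp_decreasing_open[where f = "pohozaev u"])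
      fix s assume s: "r < s" "s < 1"
      then have "C0 + \<beta> s \<le> 0" using \<beta>_antimono[of r s] r False by simp
      then have "P' s \<le> 0" unfolding P'_def using w[of s] s r by (intro mult_nonneg_nonpos) auto
      then show "\<exists>y. (pohozaev u has_real_derivative y) (at s) \<and> y \<le> 0"
        using dP[of s] s r by auto
    qed (use r in \<open>auto intro: continuous_on_subset[OF Pc]\<close>)
    moreover have "0 \<le> pohozaev u 1" using u_1 p_gt_1 by (simp add: pohozaev_def)
    ultimately show ?thesis by simp
  qed
qed

lemma exp_logZ:
  assumes r: "0 < r" "r < 1"
  shows "exp (logZ u r) = (r / u r) powr (p - 1) * (r * (b r * u r powr q))"
proof -
  have pos: "0 < u r" "0 < b r" using u_pos[of r] b_pos[of r] r by auto
  have "exp (logZ u r) = r powr p * b r * u r powr \<kappa>"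
    using pos r by (simp add: logZ_def exp_add powr_def)
  also have "r powr p = r powr (p - 1) * r" using r powr_add[of r "p - 1" 1] by simp
  also have "u r powr \<kappa> = u r powr q / u r powr (p - 1)"
    using powr_diff[of "u r" q "p - 1"] by (simp add: \<kappa>_def algebra_simps)
  finally show ?thesis using r pos by (simp add: powr_divide)
qed

lemma V_powr_e:
  assumes r: "0 < r" "r < 1"
  shows "0 < V u r" "V u r powr e = r / u r * flux u r powr e"
proof -
  have pos: "0 < u r" "0 < flux u r" using u_pos[of r] flux_pos[OF sol a_pos, of r] r by auto
  show "0 < V u r" using pos r by (simp add: V_def)
  have "(p - 1) * e = 1" using p_gt_1 by (simp add: e_def)
  then show "V u r powr e = r / u r * flux u r powr e"
    using pos r by (simp add: V_def powr_mult powr_powr)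
qed

lemma H_V:
  assumes r: "0 < r" "r < 1"
  shows "H (V u r) + exp (logZ u r) = (r / u r) powr (p - 1) / u r *
    ((p - real n) * (flux u r * u r) + (p - 1) * (r * (flux u r * flux u r powr e))
      + r * (b r * (u r * u r powr q)))"
proof -
  have pos: "0 < u r" "0 < V u r" using u_pos[of r] V_powr_e(1)[OF r] r by auto
  have "V u r powr (1 + e) = V u r * (r / u r * flux u r powr e)"
    using pos V_powr_e(2)[OF r] by (simp add: powr_add)
  then show ?thesis
    unfolding H_def exp_logZ[OF r] V_def using pos by (simp add: field_simps)
qed

text \<open>\<open>H V + Z\<close> is a combination with positive coefficients of the Pohozaev function, which is
nonnegative, and of \<open>1 - p / (q + 1)\<close>, which is positive because \<open>q + 1 > p\<close>.\<close>

lemma speed_pos: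
  assumes r: "0 < r" "r < 1"
  shows "0 < H (V u r) + exp (logZ u r)"
proof -
  define R where "R = r ^ (n - 1)"
  define y where "y = flux u r"
  define Y U where "Y = y powr e" and "U = u r powr q"
  have pos: "0 < u r" "0 < y" "0 < b r" "0 < R" "0 < U"
    using u_pos[of r] flux_pos[OF sol a_pos, of r] b_pos[of r] r by (auto simp: y_def R_def U_def)
  have "r ^ n * J u r = R * y" "r ^ n = R * r" using power_n[of r] by (auto simp: R_def y_def flux_def)
  then have "pohozaev u r = R * (r * ((p - 1) / p * (y * Y) + b r * (u r * U) / (q + 1))
      - (real n - p) / p * u r * y)"
    unfolding pohozaev_def using pos
    by (simp add: y_def[symmetric] Y_def U_def powr_add right_diff_distrib mult_ac)
  then have "0 \<le> r * ((p - 1) / p * (y * Y) + b r * (u r * U) / (q + 1)) - (real n - p) / p * u r * y"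
    using pohozaev_nonneg[OF r] pos by (simp add: zero_le_mult_iff)
  then have "0 \<le> p * (r * ((p - 1) / p * (y * Y) + b r * (u r * U) / (q + 1)) - (real n - p) / p * u r * y)"
    using p_gt_1 by (intro mult_nonneg_nonneg) auto
  also have "\<dots> = (p - 1) * (r * (y * Y)) + p / (q + 1) * (r * (b r * (u r * U))) - (real n - p) * (u r * y)"
  proof -
    define Q where "Q = q + 1"
    have "Q \<noteq> 0" using q_gt_1 by (simp add: Q_def)
    then show ?thesis unfolding Q_def[symmetric] using p_gt_1 by (simp add: field_simps)
  qed
  finally have "0 \<le> (p - 1) * (r * (y * Y)) + p / (q + 1) * (r * (b r * (u r * U))) - (real n - p) * (u r * y)" .
  moreover have "p / (q + 1) * (r * (b r * (u r * U))) < 1 * (r * (b r * (u r * U)))"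
    using pos r q_gt q_gt_1 by (intro mult_strict_right_mono) auto
  ultimately have "0 < (p - real n) * (y * u r) + (p - 1) * (r * (y * Y)) + r * (b r * (u r * U))"
    by (simp add: algebra_simps)
  then show ?thesis
    unfolding H_V[OF r] y_def[symmetric] Y_def[symmetric] U_def[symmetric] using pos r
    by (intro mult_pos_pos) auto
qed

lemma V_deriv:
  assumes r: "0 < r" "r < 1"
  shows "(V u has_real_derivative (H (V u r) + exp (logZ u r)) / r) (at r)"
proof -
  define y where "y = flux u r"
  define \<omega> where "\<omega> = (r / u r) powr (p - 1)"
  define Y U where "Y = y powr e" and "U = u r powr q"
  have pos: "0 < u r" "0 < \<omega>" using u_pos[of r] r by (auto simp: \<omega>_def)
  have F: "F u r = b r * U" using pos by (simp add: F_def U_def)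
  have dq: "((\<lambda>r. r / u r) has_real_derivative (1 * u r - r * - Y) / (u r * u r)) (at r)"
    unfolding Y_def y_def using pos
    by (intro DERIV_divide DERIV_ident solves_deriv_at[OF sol r]) auto
  have "((\<lambda>r. (r / u r) powr (p - 1)) has_real_derivative
      (p - 1) * (r / u r) powr (p - 1 - 1) * ((1 * u r - r * - Y) / (u r * u r))) (at r)"
    by (rule DERIV_chain2[OF has_real_derivative_powr dq]) (use pos r in simp)
  moreover have "(r / u r) powr (p - 1 - 1) = \<omega> / (r / u r)"
    using powr_diff[of "r / u r" "p - 1" 1] pos r by (simp add: \<omega>_def)
  ultimately have d\<omega>: "((\<lambda>r. (r / u r) powr (p - 1)) has_real_derivative
      (p - 1) * (\<omega> / (r / u r)) * ((1 * u r - r * - Y) / (u r * u r))) (at r)" by simp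
  have "(V u has_real_derivative
      (p - 1) * (\<omega> / (r / u r)) * ((1 * u r - r * - Y) / (u r * u r)) * y
      + (b r * U - (real n - 1) / r * y) * \<omega>) (at r)"
    unfolding V_def[abs_def] \<omega>_def y_def F[symmetric]
    by (intro DERIV_mult d\<omega>[unfolded \<omega>_def y_def] flux_deriv_at[OF sol r])
  moreover have "(p - 1) * (\<omega> / (r / u r)) * ((1 * u r - r * - Y) / (u r * u r)) * y
      + (b r * U - (real n - 1) / r * y) * \<omega> = (H (V u r) + exp (logZ u r)) / r"
    unfolding H_V[OF r] y_def[symmetric] \<omega>_def[symmetric] Y_def[symmetric] U_def[symmetric]
    using pos r by (simp add: field_simps)
  ultimately show ?thesis by simp
qed

lemma logZ_deriv:
  assumes r: "0 < r" "r < 1"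
  shows "(logZ u has_real_derivative (p + \<beta> r - \<kappa> * V u r powr e) / r) (at r)"
proof -
  have pos: "0 < u r" "0 < b r" using u_pos[of r] b_pos[of r] r by auto
  have "(logZ u has_real_derivative p * (1 / r) + b' r / b r + \<kappa> * (- (flux u r powr e) / u r)) (at r)"
    unfolding logZ_def[abs_def] using pos r
    by (auto intro!: derivative_eq_intros b_at solves_deriv_at[OF sol])
  moreover have "p * (1 / r) + b' r / b r + \<kappa> * (- (flux u r powr e) / u r)
      = (p + \<beta> r - \<kappa> * V u r powr e) / r"
    unfolding V_powr_e(2)[OF r] \<beta>_def using pos r by (simp add: field_simps)
  ultimately show ?thesis by simp
qed

text \<open>At the centre \<open>J\<close> tends to \<open>b 0 * a powr q / n\<close>, while \<open>V\<close> and \<open>Z\<close> are \<open>r^p\<close>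
times continuous functions of \<open>b\<close>, \<open>u\<close> and \<open>J\<close>.\<close>

lemma centre_limits:
  "((\<lambda>r. V u r / r powr p) \<longlongrightarrow> b 0 / n * a powr \<kappa>) (at_right 0)"
  "((\<lambda>r. exp (logZ u r) / V u r) \<longlongrightarrow> real n) (at_right 0)"
  "(V u \<longlongrightarrow> 0) (at_right 0)"
proof -
  have lim: "(f \<longlongrightarrow> f 0) (at_right 0)" if "continuous_on {0..1} f" for f :: "real \<Rightarrow> real"
    using that by (auto simp: continuous_on simp flip: at_within_Icc_at_right[of 0 1])
  have u0: "u 0 = a" using sol by (rule solves_0)
  have J0: "J u 0 = b 0 * a powr q / n"
    using integral_power_n[of 1 "F u 0"] a_pos u0 by (simp add: J_def F_def)
  have J0_pos: "0 < J u 0" using J_pos[OF sol a_pos, of 0] by simp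
  have lims: "(u \<longlongrightarrow> a) (at_right 0)" "(b \<longlongrightarrow> b 0) (at_right 0)" "(J u \<longlongrightarrow> J u 0) (at_right 0)"
    using lim[OF u_cont] lim[OF b_cont] lim[OF J_cont[OF u_cont]] u0 by auto
  have ev: "eventually (\<lambda>r::real. 0 < r \<and> r < 1) (at_right 0)"
    unfolding eventually_at_right_field by (intro exI[of _ 1]) auto
  have "((\<lambda>r. J u r / u r powr (p - 1)) \<longlongrightarrow> J u 0 / a powr (p - 1)) (at_right 0)"
    using a_pos by (intro tendsto_intros lims) auto
  moreover have "eventually (\<lambda>r. J u r / u r powr (p - 1) = V u r / r powr p) (at_right 0)"
    using ev
  proof eventually_elim
    case (elim r)
    then have "r powr p = r powr (p - 1) * r" using powr_add[of r "p - 1" 1] by simp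
    then show ?case using elim u_pos[of r] by (simp add: V_def flux_def powr_divide)
  qed
  moreover have "J u 0 / a powr (p - 1) = b 0 / n * a powr \<kappa>"
  proof -
    have "a powr \<kappa> = a powr q / a powr (p - 1)"
      using powr_diff[of a q "p - 1"] by (simp add: \<kappa>_def algebra_simps)
    then show ?thesis by (simp add: J0)
  qed
  ultimately show 1: "((\<lambda>r. V u r / r powr p) \<longlongrightarrow> b 0 / n * a powr \<kappa>) (at_right 0)"
    by (simp add: tendsto_cong)
  have "((\<lambda>r. b r * u r powr q / J u r) \<longlongrightarrow> b 0 * a powr q / J u 0) (at_right 0)"
    using a_pos J0_pos by (intro tendsto_intros lims) auto
  moreover have "eventually (\<lambda>r. b r * u r powr q / J u r = exp (logZ u r) / V u r) (at_right 0)"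
    using ev
  proof eventually_elim
    case (elim r)
    then show ?case using u_pos[of r] by (simp add: exp_logZ V_def flux_def)
  qed
  moreover have "b 0 * a powr q / J u 0 = real n"
    using b_0_pos a_pos n_ge_1 by (simp add: J0)
  ultimately show "((\<lambda>r. exp (logZ u r) / V u r) \<longlongrightarrow> real n) (at_right 0)"
    by (simp add: tendsto_cong)
  have "((\<lambda>r::real. r powr p) \<longlongrightarrow> 0) (at_right 0)"
    using p_gt_1 by (intro tendsto_eq_intros) (auto intro: eventually_at_right_less[THEN eventually_mono])
  from tendsto_mult[OF 1 this]
  have "((\<lambda>r. V u r / r powr p * r powr p) \<longlongrightarrow> 0) (at_right 0)" by simp
  moreover have "eventually (\<lambda>r. V u r / r powr p * r powr p = V u r) (at_right 0)"
    using ev by eventually_elim auto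
  ultimately show "(V u \<longlongrightarrow> 0) (at_right 0)" by (simp add: tendsto_cong)
qed

text \<open>At \<open>r = 1\<close> the flux is positive while \<open>u\<close> vanishes.\<close>

lemma V_at_boundary: "filterlim (V u) at_top (at_left 1)"
proof -
  have lim: "(f \<longlongrightarrow> f 1) (at_left 1)" if "continuous_on {0..1} f" for f :: "real \<Rightarrow> real"
    using that by (auto simp: continuous_on simp flip: at_within_Icc_at_left[of 0 1])
  have ev: "eventually (\<lambda>r::real. 0 < r \<and> r < 1) (at_left 1)"
    unfolding eventually_at_left_field by (intro exI[of _ 0]) auto
  have "((\<lambda>r. r powr (p - 1) * (r * J u r)) \<longlongrightarrow> 1 powr (p - 1) * (1 * J u 1)) (at_left 1)"
    using lim[OF J_cont[OF u_cont]] by (intro tendsto_intros) auto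
  moreover have "0 < 1 powr (p - 1) * (1 * J u 1)" using J_pos[OF sol a_pos, of 1] by simp
  moreover have "filterlim (\<lambda>r. inverse (u r powr (p - 1))) at_top (at_left 1)"
  proof (rule filterlim_inverse_at_top)
    have "((\<lambda>r. u r powr (p - 1)) \<longlongrightarrow> 0 powr (p - 1)) (at_left 1)"
      using lim[OF u_cont] u_1 p_gt_1
      by (intro tendsto_powr') (auto intro: eventually_mono[OF ev] less_imp_le u_pos)
    then show "((\<lambda>r. u r powr (p - 1)) \<longlongrightarrow> 0) (at_left 1)" by simp
    show "eventually (\<lambda>r. 0 < u r powr (p - 1)) (at_left 1)"
      using ev
    proof eventually_elim
      case (elim r)
      then show ?case using u_pos[of r] by simp
    qed
  qed
  ultimately have "filterlim (\<lambda>r. r powr (p - 1) * (r * J u r) * inverse (u r powr (p - 1))) at_top (at_left 1)"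
    by (rule filterlim_tendsto_pos_mult_at_top)
  moreover have "eventually (\<lambda>r. r powr (p - 1) * (r * J u r) * inverse (u r powr (p - 1)) = V u r) (at_left 1)"
    using ev
  proof eventually_elim
    case (elim r)
    then have "(r / u r) powr (p - 1) = r powr (p - 1) * inverse (u r powr (p - 1))"
      using u_pos[of r] by (simp add: powr_divide) (simp add: divide_inverse)
    then show ?case by (simp add: V_def flux_def)
  qed
  ultimately show ?thesis by (simp add: filterlim_cong[OF refl refl])
qed

lemma phase_curve_exists: "\<exists>t L. phase_curve (b 0 / n * a powr \<kappa>) t L"
proof -
  have "0 < (H (V u r) + exp (logZ u r)) / r" if "0 < r" "r < 1" for r
    using speed_pos[OF that] that by simp
  note inv = increasing_inverse[OF V_deriv this centre_limits(3) V_at_boundary]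
  obtain g where g: "\<And>v. 0 < v \<Longrightarrow> 0 < g v \<and> g v < 1 \<and> V u (g v) = v"
    and dg: "\<And>v. 0 < v \<Longrightarrow> (g has_real_derivative 1 / ((H (V u (g v)) + exp (logZ u (g v))) / g v)) (at v)"
    and g_lim: "(g \<longlongrightarrow> 0) (at_right 0)" "(g \<longlongrightarrow> 1) at_top"
    by (rule inv) (assumption | rule that; blast)+
  have ev: "eventually (\<lambda>v::real. 0 < v) (at_right 0)" by (rule eventually_at_right_less)
  have g0: "filterlim g (at_right 0) (at_right 0)"
  proof (rule filterlim_at_withinI[OF g_lim(1)])
    show "eventually (\<lambda>v. g v \<in> {0<..} - {0}) (at_right 0)"
      using ev by eventually_elim (use g in auto)
  qed
  define t where "t v = ln (g v)" for v
  define L where "L v = logZ u (g v)" for v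
  have et: "exp (t v) = g v" if "0 < v" for v using g[OF that] by (simp add: t_def)
  have 1: "t v < 0" "0 < H v + exp (L v)" if "0 < v" for v
    using g[OF that] speed_pos[of "g v"] by (auto simp: t_def L_def)
  have 2: "(t has_real_derivative 1 / (H v + exp (L v))) (at v)" if v: "0 < v" for v
  proof -
    have "(t has_real_derivative 1 / g v * (1 / ((H (V u (g v)) + exp (logZ u (g v))) / g v))) (at v)"
      unfolding t_def[abs_def]
      by (rule DERIV_chain2[OF DERIV_ln_divide dg[OF v]]) (use g[OF v] in simp)
    then show ?thesis using g[OF v] by (simp add: L_def)
  qed
  have 3: "(L has_real_derivative (p + \<beta> (exp (t v)) - \<kappa> * v powr e) / (H v + exp (L v))) (at v)"
    if v: "0 < v" for v
  proof -
    have "(L has_real_derivative (p + \<beta> (g v) - \<kappa> * V u (g v) powr e) / g v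
        * (1 / ((H (V u (g v)) + exp (logZ u (g v))) / g v))) (at v)"
      unfolding L_def[abs_def]
      by (rule DERIV_chain2[OF logZ_deriv dg[OF v]]) (use g[OF v] in auto)
    then show ?thesis using g[OF v] by (simp add: L_def et[OF v])
  qed
  have cong: "(f \<longlongrightarrow> l) (at_right 0)"
    if "(h \<longlongrightarrow> l) (at_right 0)" "\<And>v. 0 < v \<Longrightarrow> h v = f v" for f h :: "real \<Rightarrow> real" and l
    using that(1) by (rule Lim_transform_eventually) (use that(2) in \<open>auto intro: eventually_mono[OF ev]\<close>)
  have 4: "((\<lambda>v. exp (t v)) \<longlongrightarrow> 0) (at_right 0)"
    by (rule cong[OF g_lim(1)]) (simp add: et)
  have 5: "((\<lambda>v. v / exp (t v) powr p) \<longlongrightarrow> b 0 / n * a powr \<kappa>) (at_right 0)"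
    by (rule cong[OF filterlim_compose[OF centre_limits(1) g0]]) (simp add: et g)
  have 6: "((\<lambda>v. exp (L v) / v) \<longlongrightarrow> real n) (at_right 0)"
    by (rule cong[OF filterlim_compose[OF centre_limits(2) g0]]) (simp add: L_def g)
  have 7: "(t \<longlongrightarrow> 0) at_top"
    unfolding t_def[abs_def] using tendsto_ln[OF g_lim(2)] by simp
  show ?thesis
    unfolding phase_curve_def using 1 2 3 4 5 6 7 by (intro exI[of _ t] exI[of _ L] conjI allI impI) auto
qed

end

lemma larger_centre_value_impossible:
  assumes "solves a u" "solves c v" "u 1 = 0" "v 1 = 0" "0 < c" "c < a"
  shows False
proof -
  obtain t1 L1 where 1: "phase_curve (b 0 / n * a powr \<kappa>) t1 L1"
    using phase_curve_exists[of a u] assms by auto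
  obtain t2 L2 where 2: "phase_curve (b 0 / n * c powr \<kappa>) t2 L2"
    using phase_curve_exists[of c v] assms by auto
  have "c powr \<kappa> < a powr \<kappa>" using assms \<kappa>_pos by (intro powr_less_mono2) auto
  then show False
    using phase_curve_order[OF 1 2] assms b_0_pos n_ge_1 by (simp add: divide_strict_right_mono)
qed

lemma positive_solution_unique:
  assumes "positive_solution n p q b u" "positive_solution n p q b v" "r \<in> {0..1}"
  shows "u r = v r"
proof -
  note u = positive_solution_solves[OF assms(1)] and v = positive_solution_solves[OF assms(2)]
  have "u 0 = v 0"
    using larger_centre_value_impossible[OF u(1) v(1) u(3) v(3) v(2)]
      larger_centre_value_impossible[OF v(1) u(1) v(3) u(3) u(2)]
    by (cases "u 0" "v 0" rule: linorder_cases) auto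
  then show ?thesis using solves_unique[OF u(2,1) _ assms(3), of v] v(1) by simp
qed

end

theorem theorem2p4:
  fixes n :: nat and p q :: real and b b' :: "real \<Rightarrow> real"
  assumes "n \<ge> 1" and "p > 1"
    and "max 1 (p - 1) < q"
    and "p < real n \<longrightarrow> q < (real n * p - real n + p) / (real n - p)"
    and "has_C1_derivative_on b b' {0..1}"
    and "\<forall>r\<in>{0<..<1}. b r > 0 \<and> b' r < 0"
    and "antimono_on {0<..<1} (\<lambda>r. r * b' r / b r)"
    and "antimono_on {0<..<1} (\<lambda>r. r * b' r)"
  shows "(\<exists>u. positive_solution n p q b u) \<and>
         (\<forall>u v. positive_solution n p q b u \<longrightarrow> positive_solution n p q b v \<longrightarrow>
            (\<forall>r\<in>{0..1}. u r = v r))"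
proof -
  have sub: "0 < real n - (real n - p) * (q + 1) / p"
  proof (cases "p < real n")
    case True
    then have "q * (real n - p) < real n * p - real n + p"
      using assms(4) by (simp add: pos_less_divide_eq)
    then have "(real n - p) * (q + 1) < real n * p" by (simp add: algebra_simps)
    then show ?thesis using assms(2) by (simp add: pos_divide_less_eq)
  next
    case False
    then have "(real n - p) * (q + 1) / p \<le> 0"
      using assms(2,3) by (intro divide_nonpos_pos mult_nonpos_nonneg) auto
    then show ?thesis using assms(1) by linarith
  qed
  interpret radial_problem n p q b b'
    using assms sub
    by unfold_locales (auto simp: has_C1_derivative_on_def monotone_on_def)
  show ?thesis
    using positive_solution_exists positive_solution_unique by blast
qed

end
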